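(* Let $\Lambda=\{\Lambda_n^Q\}_{n\ge1}$ be an arbitrary sequence of quantum channels (CPTP maps) $\Lambda_n^Q:\mathcal{B}(\mathcal{K}_Q^{(n)})\to\mathcal{B}(\mathcal{H}_Q^{(n)})$ between finite-dimensional Hilbert spaces. Then its classical capacity is \[ C(\Lambda)=\sup_{\rho^{AQ}\in\mathcal{S}}\underline{S}(A:\Lambda Q), \] where $\mathcal{S}$ is the set of sequences $\rho^{AQ}=\{\rho_n^{AQ}\}$ of separable states on $\mathcal{H}_A^{(n)}\otimes\mathcal{K}_Q^{(n)}$ (over all finite-dimensional auxiliary spaces $\mathcal{H}_A^{(n)}$), and $\underline{S}(A:\Lambda Q)$ is the inf-spectral mutual information rate of the sequence $\rho_n^{A\Lambda Q}:=(\mathrm{id}_A\otimes\Lambda_n^Q)(\rho_n^{AQ})$.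
   Context: Logarithms are natural. For self-adjoint $A=\sum_i\lambda_i|i\rangle\langle i|$, $\{A\ge0\}:=\sum_{\lambda_i\ge0}|i\rangle\langle i|$ and $\{A\ge B\}:=\{A-B\ge0\}$. For a sequence of bipartite states $\rho^{XY}=\{\rho^{XY}_n\}$ with marginals $\rho^X_n,\rho^Y_n$, the inf-spectral mutual information rate is \[ \underline{S}(X:Y)=\sup\Big\{\gamma:\ \liminf_{n\to\infty}\mathrm{Tr}\big[\{\Pi_n(\gamma)\ge0\}\Pi_n(\gamma)\big]=1\Big\},\quad \Pi_n(\gamma)=\rho_n^{XY}-e^{n\gamma}\rho_n^X\otimes\rho_n^Y. \] A code $\mathcal{C}^{(n)}$ of size $M_n$ for $\Lambda_n^Q$ consists of states $\rho_n^i$ on $\mathcal{K}_Q^{(n)}$ and positive operators $E_n^i$ on $\mathcal{H}_Q^{(n)}$, $i=1,\dots,M_n$, with $\sum_iE_n^i\le I$; its average error probability is $P_e(\mathcal{C}^{(n)})=\frac1{M_n}\sum_{i=1}^{M_n}(1-\mathrm{Tr}(\Lambda_n^Q(\rho_n^i)E_n^i))$. A rate $R$ is achievable if there is a sequence of codes with $M_n\ge e^{nR}$ for all sufficiently large $n$ and $P_e(\mathcal{C}^{(n)})\to0$. The classical capacity $C(\Lambda)$ is the supremum of achievable rates. *)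

theory Defs
  imports Complex_Main "HOL-Library.Extended_Real" "Jordan_Normal_Form.Matrix"
begin

definition mtrace :: "complex mat \<Rightarrow> complex" where
  "mtrace A = (\<Sum>i<dim_row A. A $$ (i,i))"

definition adj :: "complex mat \<Rightarrow> complex mat" where
  "adj A = mat (dim_col A) (dim_row A) (\<lambda>(i,j). cnj (A $$ (j,i)))"

definition hermitian :: "nat \<Rightarrow> complex mat \<Rightarrow> bool" where
  "hermitian d A \<longleftrightarrow> A \<in> carrier_mat d d \<and> adj A = A"

definition psd :: "nat \<Rightarrow> complex mat \<Rightarrow> bool" where
  "psd d A \<longleftrightarrow> hermitian d A \<and>
     (\<forall>v \<in> carrier_vec d. 0 \<le> Re (\<Sum>i<d. cnj (v $ i) * (A *\<^sub>v v) $ i))"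

definition density :: "nat \<Rightarrow> complex mat \<Rightarrow> bool" where
  "density d \<rho> \<longleftrightarrow> psd d \<rho> \<and> mtrace \<rho> = 1"

definition unitary :: "nat \<Rightarrow> complex mat \<Rightarrow> bool" where
  "unitary d U \<longleftrightarrow> U \<in> carrier_mat d d \<and> adj U * U = 1\<^sub>m d \<and> U * adj U = 1\<^sub>m d"

text \<open>Kronecker (tensor) product, first factor is the outer index\<close>
definition kron :: "complex mat \<Rightarrow> complex mat \<Rightarrow> complex mat" where
  "kron A B = mat (dim_row A * dim_row B) (dim_col A * dim_col B)
     (\<lambda>(i,j). A $$ (i div dim_row B, j div dim_col B) * B $$ (i mod dim_row B, j mod dim_col B))"

definition ptrace2 :: "nat \<Rightarrow> nat \<Rightarrow> complex mat \<Rightarrow> complex mat" where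
  "ptrace2 dX dY R = mat dX dX (\<lambda>(a,b). \<Sum>k<dY. R $$ (a*dY + k, b*dY + k))"

definition ptrace1 :: "nat \<Rightarrow> nat \<Rightarrow> complex mat \<Rightarrow> complex mat" where
  "ptrace1 dX dY R = mat dY dY (\<lambda>(k,l). \<Sum>a<dX. R $$ (a*dY + k, a*dY + l))"

definition block :: "nat \<Rightarrow> complex mat \<Rightarrow> nat \<Rightarrow> nat \<Rightarrow> complex mat" where
  "block dK X a b = mat dK dK (\<lambda>(k,l). X $$ (a*dK + k, b*dK + l))"

definition id_tensor :: "nat \<Rightarrow> nat \<Rightarrow> nat \<Rightarrow> (complex mat \<Rightarrow> complex mat) \<Rightarrow> complex mat \<Rightarrow> complex mat" where
  "id_tensor dA dK dH \<Phi> X = mat (dA*dH) (dA*dH)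
     (\<lambda>(i,j). \<Phi> (block dK X (i div dH) (j div dH)) $$ (i mod dH, j mod dH))"

definition linear_map :: "nat \<Rightarrow> nat \<Rightarrow> (complex mat \<Rightarrow> complex mat) \<Rightarrow> bool" where
  "linear_map dK dH \<Phi> \<longleftrightarrow>
     (\<forall>X \<in> carrier_mat dK dK. \<Phi> X \<in> carrier_mat dH dH) \<and>
     (\<forall>X \<in> carrier_mat dK dK. \<forall>Y \<in> carrier_mat dK dK. \<forall>a b.
        \<Phi> (a \<cdot>\<^sub>m X + b \<cdot>\<^sub>m Y) = a \<cdot>\<^sub>m \<Phi> X + b \<cdot>\<^sub>m \<Phi> Y)"

definition cptp :: "nat \<Rightarrow> nat \<Rightarrow> (complex mat \<Rightarrow> complex mat) \<Rightarrow> bool" where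
  "cptp dK dH \<Phi> \<longleftrightarrow> linear_map dK dH \<Phi> \<and>
     (\<forall>X \<in> carrier_mat dK dK. mtrace (\<Phi> X) = mtrace X) \<and>
     (\<forall>m X. psd (m*dK) X \<longrightarrow> psd (m*dH) (id_tensor m dK dH \<Phi> X))"

definition separable :: "nat \<Rightarrow> nat \<Rightarrow> complex mat \<Rightarrow> bool" where
  "separable dA dK \<rho> \<longleftrightarrow> (\<exists>(N::nat) (p::nat \<Rightarrow> real) \<sigma> \<tau>.
     (\<forall>i<N. 0 \<le> p i \<and> density dA (\<sigma> i) \<and> density dK (\<tau> i)) \<and> (\<Sum>i<N. p i) = 1 \<and>
     \<rho> = mat (dA*dK) (dA*dK) (\<lambda>(r,c). \<Sum>i<N. complex_of_real (p i) * kron (\<sigma> i) (\<tau> i) $$ (r,c)))"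

text \<open>{A \<ge> 0}: projection onto the span of eigenvectors of the Hermitian A with
  nonnegative eigenvalues, computed from a spectral decomposition A = U D U^*
  (independent of the chosen decomposition)\<close>
definition nonneg_proj :: "nat \<Rightarrow> complex mat \<Rightarrow> complex mat" where
  "nonneg_proj d A = (let (U, ev) = (SOME (U, ev::nat \<Rightarrow> real). unitary d U \<and>
        A = U * mat d d (\<lambda>(i,j). if i = j then complex_of_real (ev i) else 0) * adj U)
     in U * mat d d (\<lambda>(i,j). if i = j \<and> 0 \<le> ev i then 1 else 0) * adj U)"

definition inf_spec_MI :: "(nat \<Rightarrow> nat) \<Rightarrow> (nat \<Rightarrow> nat) \<Rightarrow> (nat \<Rightarrow> complex mat) \<Rightarrow> ereal" where
  "inf_spec_MI dX dY R = Sup (ereal ` {\<gamma>::real.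
     liminf (\<lambda>n. let d = dX n * dY n;
                     Pg = R n - complex_of_real (exp (real n * \<gamma>)) \<cdot>\<^sub>m
                            kron (ptrace2 (dX n) (dY n) (R n)) (ptrace1 (dX n) (dY n) (R n))
                 in ereal (Re (mtrace (nonneg_proj d Pg * Pg)))) = 1})"

definition is_code :: "nat \<Rightarrow> nat \<Rightarrow> nat \<Rightarrow> (nat \<Rightarrow> complex mat) \<Rightarrow> (nat \<Rightarrow> complex mat) \<Rightarrow> bool" where
  "is_code dK dH M \<rho> E \<longleftrightarrow> 1 \<le> M \<and>
     (\<forall>i \<in> {1..M}. density dK (\<rho> i) \<and> psd dH (E i)) \<and>
     psd dH (1\<^sub>m dH - mat dH dH (\<lambda>(r,c). \<Sum>i=1..M. E i $$ (r,c)))"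

definition avg_error :: "(complex mat \<Rightarrow> complex mat) \<Rightarrow> nat \<Rightarrow> (nat \<Rightarrow> complex mat) \<Rightarrow> (nat \<Rightarrow> complex mat) \<Rightarrow> real" where
  "avg_error \<Phi> M \<rho> E = (1 / real M) * (\<Sum>i=1..M. 1 - Re (mtrace (\<Phi> (\<rho> i) * E i)))"

definition achievable :: "(nat \<Rightarrow> nat) \<Rightarrow> (nat \<Rightarrow> nat) \<Rightarrow> (nat \<Rightarrow> complex mat \<Rightarrow> complex mat) \<Rightarrow> real \<Rightarrow> bool" where
  "achievable dK dH \<Lambda> R \<longleftrightarrow> (\<exists>(M::nat \<Rightarrow> nat) (\<rho>::nat \<Rightarrow> nat \<Rightarrow> complex mat) E.
     (\<forall>n\<ge>1. is_code (dK n) (dH n) (M n) (\<rho> n) (E n)) \<and>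
     (\<forall>\<^sub>F n in sequentially. exp (real n * R) \<le> real (M n)) \<and>
     (\<lambda>n. avg_error (\<Lambda> n) (M n) (\<rho> n) (E n)) \<longlonglongrightarrow> 0)"

definition classical_capacity :: "(nat \<Rightarrow> nat) \<Rightarrow> (nat \<Rightarrow> nat) \<Rightarrow> (nat \<Rightarrow> complex mat \<Rightarrow> complex mat) \<Rightarrow> ereal" where
  "classical_capacity dK dH \<Lambda> = Sup (ereal ` {R. achievable dK dH \<Lambda> R})"

end

theory Submission
  imports Defs "Jordan_Normal_Form.Spectral_Radius" "HOL-Library.Function_Algebras"
begin

text \<open>
  Converse: for a code with states \<open>\<rho>\<^sub>i\<close> and measurement \<open>E\<^sub>i\<close>, take the classical-quantum input
  \<open>(1/M) \<Sum>\<^sub>i |i\<rangle>\<langle>i| \<otimes> \<rho>\<^sub>i\<close> and the test \<open>T = \<Sum>\<^sub>i |i\<rangle>\<langle>i| \<otimes> E\<^sub>i\<close>. As \<open>{\<Pi> \<ge> 0}\<close> maximises \<open>Tr[T \<Pi>]\<close> over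
  \<open>0 \<le> T \<le> I\<close>, the spectral quantity is at least \<open>1 - P\<^sub>e - e\<^bsup>n\<gamma>\<^esup> / M\<close>.

  Achievability: for an input \<open>\<Sum>\<^sub>i p\<^sub>i \<sigma>\<^sub>i \<otimes> \<tau>\<^sub>i\<close> and \<open>P = {\<Pi> \<ge> 0}\<close>, the effects \<open>T\<^sub>i = Tr\<^sub>A[(\<sigma>\<^sub>i \<otimes> I) P]\<close> on the
  output space satisfy \<open>\<Sum>\<^sub>i p\<^sub>i Tr[T\<^sub>i \<Lambda>(\<tau>\<^sub>i)] = Tr[P \<rho>]\<close> and \<open>\<Sum>\<^sub>i\<^sub>j p\<^sub>i p\<^sub>j Tr[T\<^sub>i \<Lambda>(\<tau>\<^sub>j)] = Tr[P (\<rho>\<^sub>A \<otimes> \<rho>\<^sub>Q)]\<close>.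
  Draw \<open>M = \<lceil>e\<^bsup>n\<gamma>\<^esup>\<rceil>\<close> codewords from \<open>p\<close> and decode with \<open>4 K T\<^sub>m K\<close>, where \<open>K = (I + S)\<^sup>-\<^sup>1\<close> and \<open>S\<close> is the sum of
  the effects of the codebook. This replaces the square-root measurement, and
  \<open>I - 4 K T\<^sub>m K \<le> 6 (I - T\<^sub>m) + 8 (S - T\<^sub>m)\<close> takes the place of the Hayashi--Nagaoka inequality.
  The average error is then at most \<open>14 (1 - Tr[P \<Pi>])\<close>, so \<open>\<gamma>\<close> itself is achievable.
\<close>

section \<open>Spectral theorem for Hermitian matrices\<close>

lemma index_mult_mat_sum:
  assumes "A \<in> carrier_mat m n" "B \<in> carrier_mat n p" "i < m" "j < p"
  shows "(A * B) $$ (i,j) = (\<Sum>k<n. A $$ (i,k) * B $$ (k,j))"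
  using assms by (simp add: scalar_prod_def lessThan_atLeast0)

lemma mult_square_carrier [simp]:
  "A \<in> carrier_mat n n \<Longrightarrow> B \<in> carrier_mat n n \<Longrightarrow> A * B \<in> carrier_mat n n"
  by simp

lemma adj_square_carrier [simp]: "A \<in> carrier_mat n n \<Longrightarrow> adj A \<in> carrier_mat n n"
  by (auto simp: adj_def)

lemma adj_carrier [simp]: "A \<in> carrier_mat m n \<Longrightarrow> adj A \<in> carrier_mat n m"
  by (auto simp: adj_def)

lemma adj_index [simp]: "i < dim_col A \<Longrightarrow> j < dim_row A \<Longrightarrow> adj A $$ (i,j) = cnj (A $$ (j,i))"
  by (simp add: adj_def)

lemma adj_dim [simp]: "dim_row (adj A) = dim_col A" "dim_col (adj A) = dim_row A"
  by (simp_all add: adj_def)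

lemma adj_adj [simp]: "adj (adj A) = A"
  by (rule eq_matI) auto

lemma adj_mult:
  assumes "A \<in> carrier_mat m n" "B \<in> carrier_mat n p"
  shows "adj (A * B) = adj B * adj A"
proof (rule eq_matI)
  fix i j assume "i < dim_row (adj B * adj A)" "j < dim_col (adj B * adj A)"
  then have ij: "i < p" "j < m" using assms by auto
  have "(adj B * adj A) $$ (i,j) = (\<Sum>k<n. adj B $$ (i,k) * adj A $$ (k,j))"
    by (rule index_mult_mat_sum) (use assms ij in auto)
  also have "\<dots> = cnj (\<Sum>k<n. A $$ (j,k) * B $$ (k,i))"
    using assms ij by (simp add: mult.commute)
  also have "\<dots> = adj (A * B) $$ (i,j)"
    using assms ij index_mult_mat_sum[of A m n B p j i] by simp
  finally show "adj (A * B) $$ (i,j) = (adj B * adj A) $$ (i,j)" by simp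
qed (use assms in auto)

lemma hermitian_iff:
  "hermitian d A \<longleftrightarrow> A \<in> carrier_mat d d \<and> (\<forall>i<d. \<forall>j<d. A $$ (i,j) = cnj (A $$ (j,i)))"
proof -
  have "adj A = A \<longleftrightarrow> (\<forall>i<d. \<forall>j<d. A $$ (i,j) = cnj (A $$ (j,i)))" if "A \<in> carrier_mat d d"
  proof
    assume "adj A = A"
    then show "\<forall>i<d. \<forall>j<d. A $$ (i,j) = cnj (A $$ (j,i))"
      using that adj_index[of _ A] by (metis carrier_matD)
  next
    assume "\<forall>i<d. \<forall>j<d. A $$ (i,j) = cnj (A $$ (j,i))"
    then have "adj A $$ (i,j) = A $$ (i,j)" if "i < d" "j < d" for i j
      using that \<open>A \<in> carrier_mat d d\<close> by (metis adj_index carrier_matD)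
    then show "adj A = A" using that by (intro eq_matI) auto
  qed
  then show ?thesis by (auto simp: hermitian_def)
qed

lemma unitary_mult:
  assumes "unitary n U" "unitary n V"
  shows "unitary n (U * V)"
proof -
  have c: "U \<in> carrier_mat n n" "V \<in> carrier_mat n n" "adj U \<in> carrier_mat n n" "adj V \<in> carrier_mat n n"
    using assms by (auto simp: unitary_def)
  have "adj (U * V) * (U * V) = adj V * ((adj U * U) * V)"
    using c by (simp add: adj_mult[OF c(1,2)] assoc_mult_mat[of _ n n _ n _ n])
  also have "\<dots> = 1\<^sub>m n" using assms c by (simp add: unitary_def)
  finally have 1: "adj (U * V) * (U * V) = 1\<^sub>m n" .
  have "(U * V) * adj (U * V) = U * ((V * adj V) * adj U)"
    using c by (simp add: adj_mult[OF c(1,2)] assoc_mult_mat[of _ n n _ n _ n])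
  also have "\<dots> = 1\<^sub>m n" using assms c by (simp add: unitary_def)
  finally show ?thesis using 1 c by (simp add: unitary_def)
qed

lemma unitary_of_isometry:
  assumes "U \<in> carrier_mat n n" "adj U * U = 1\<^sub>m n"
  shows "unitary n U"
  using assms mat_mult_left_right_inverse[of "adj U" n U] by (simp add: unitary_def)

text \<open>Gram-Schmidt applied to a basis that begins with \<open>v\<close> keeps \<open>v\<close>
  in first place, so normalising the orthogonal family gives an orthonormal one whose first member
  is parallel to \<open>v\<close>. A multiple of an eigenvector is as good as the eigenvector
  itself, so the scalar \<open>c\<close> is left unspecified.\<close>

lemma unitary_with_first_column:
  fixes v :: "complex vec"
  assumes v: "v \<in> carrier_vec n" and v0: "v \<noteq> 0\<^sub>v n"
  obtains W c where "unitary n W" "\<And>i. i < n \<Longrightarrow> W $$ (i,0) = c * v $ i"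
proof -
  interpret cof_vec_space n "TYPE(complex)" .
  define b where "b = basis_completion v"
  define ws where "ws = gram_schmidt n b"
  from basis_completion[OF v v0, folded b_def]
  have dist_b: "distinct b" and indep: "\<not> lin_dep (set b)" and b: "set b \<subseteq> carrier_vec n"
    and hdb: "hd b = v" and len_b: "length b = n" by auto
  have n: "n \<noteq> 0" using v v0 by (cases n) auto
  from hdb len_b n obtain vs where bv: "b = v # vs" by (cases b, auto)
  from gram_schmidt_result[OF b dist_b indep refl, folded ws_def]
  have ws: "set ws \<subseteq> carrier_vec n" "corthogonal ws" "length ws = n"
    by (auto simp: len_b)
  from gram_schmidt_hd[OF v, of vs, folded bv] have "hd ws = v" unfolding ws_def .
  then have ws0: "ws ! 0 = v" using ws(3) n by (cases ws) auto
  have wc: "ws ! i \<in> carrier_vec n" if "i < n" for i using ws that by auto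
  define s where "s i j = (\<Sum>k<n. cnj (ws ! i $ k) * ws ! j $ k)" for i j
  have sdot: "ws ! j \<bullet>c ws ! i = s i j" if "i < n" "j < n" for i j
    using wc[OF that(1)] wc[OF that(2)] by (simp add: s_def scalar_prod_def lessThan_atLeast0 mult.commute)
  have s_off: "s i j = 0" if "i < n" "j < n" "i \<noteq> j" for i j
    using corthogonalD[OF ws(2), of j i] sdot[OF that(1,2)] that ws(3) by auto
  have s_ne: "s i i \<noteq> 0" if "i < n" for i
    using corthogonalD[OF ws(2), of i i] sdot[OF that that] that ws(3) by auto
  define r where "r i = (\<Sum>k<n. (cmod (ws ! i $ k))\<^sup>2)" for i
  have s_r: "s i i = complex_of_real (r i)" for i
    unfolding s_def r_def of_real_sum
    by (intro sum.cong refl) (metis complex_norm_square mult.commute)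
  have r_pos: "r i > 0" if "i < n" for i
  proof -
    have "r i \<ge> 0" unfolding r_def by (intro sum_nonneg) auto
    moreover have "r i \<noteq> 0" using s_ne[OF that] s_r[of i] by auto
    ultimately show ?thesis by simp
  qed
  define W where "W = mat n n (\<lambda>(i,j). complex_of_real (1 / sqrt (r j)) * ws ! j $ i)"
  have W: "W \<in> carrier_mat n n" by (simp add: W_def)
  have "adj W * W = 1\<^sub>m n"
  proof (rule eq_matI)
    fix i j assume "i < dim_row (1\<^sub>m n :: complex mat)" "j < dim_col (1\<^sub>m n :: complex mat)"
    then have ij: "i < n" "j < n" by auto
    have "(adj W * W) $$ (i,j) = (\<Sum>k<n. adj W $$ (i,k) * W $$ (k,j))"
      by (rule index_mult_mat_sum) (use W ij in auto)
    also have "\<dots> = (\<Sum>k<n. complex_of_real (1 / sqrt (r i)) * complex_of_real (1 / sqrt (r j)) *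
        (cnj (ws ! i $ k) * ws ! j $ k))"
      using ij by (intro sum.cong refl) (simp add: W_def)
    also have "\<dots> = complex_of_real (1 / sqrt (r i)) * complex_of_real (1 / sqrt (r j)) * s i j"
      by (simp add: s_def sum_distrib_left)
    also have "\<dots> = 1\<^sub>m n $$ (i,j)"
    proof (cases "i = j")
      case True
      have "complex_of_real (1 / sqrt (r i)) * complex_of_real (1 / sqrt (r j)) * s i j =
          complex_of_real (1 / sqrt (r i) * (1 / sqrt (r i)) * r i)"
        unfolding True s_r by (simp only: of_real_mult)
      also have "1 / sqrt (r i) * (1 / sqrt (r i)) * r i = 1"
        using r_pos[OF ij(1)] by (simp add: field_simps)
      finally show ?thesis using True ij by simp
    qed (use s_off ij in auto)
    finally show "(adj W * W) $$ (i,j) = 1\<^sub>m n $$ (i,j)" .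
  qed (use W in auto)
  then have "unitary n W" using W by (rule unitary_of_isometry[rotated])
  moreover have "W $$ (i,0) = complex_of_real (1 / sqrt (r 0)) * v $ i" if "i < n" for i
    using that n by (simp add: W_def ws0)
  ultimately show ?thesis by (rule that)
qed

text \<open>The matrix is spelled as inside the \<open>SOME\<close> of \<open>nonneg_proj\<close>,
  so the decomposition chosen there becomes \<open>U * diag_real d ev * adj U\<close> on
  unfolding.\<close>

definition diag_real :: "nat \<Rightarrow> (nat \<Rightarrow> real) \<Rightarrow> complex mat" where
  "diag_real d ev = mat d d (\<lambda>(i,j). if i = j then complex_of_real (ev i) else 0)"

lemma diag_real_carrier [simp]: "diag_real d ev \<in> carrier_mat d d"
  and diag_real_dim [simp]: "dim_row (diag_real d ev) = d" "dim_col (diag_real d ev) = d"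
  and diag_real_index [simp]:
    "i < d \<Longrightarrow> j < d \<Longrightarrow> diag_real d ev $$ (i,j) = (if i = j then complex_of_real (ev i) else 0)"
  by (auto simp: diag_real_def)

text \<open>The spectral decomposition as a weighted sum of rank-one matrices built from the columns
  of \<open>U\<close>. Quadratic forms and traces are computed from this form below.\<close>

lemma conj_diag_index:
  assumes U: "U \<in> carrier_mat d d" and ij: "i < d" "j < d"
  shows "(U * diag_real d ev * adj U) $$ (i,j) =
    (\<Sum>k<d. complex_of_real (ev k) * U $$ (i,k) * cnj (U $$ (j,k)))"
proof -
  have UD: "(U * diag_real d ev) $$ (i,k) = complex_of_real (ev k) * U $$ (i,k)" if "k < d" for k
  proof -
    have "(U * diag_real d ev) $$ (i,k) =
        (\<Sum>l<d. U $$ (i,l) * diag_real d ev $$ (l,k))"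
      by (rule index_mult_mat_sum) (use U ij that in auto)
    also have "\<dots> = (\<Sum>l<d. if l = k then complex_of_real (ev k) * U $$ (i,k) else 0)"
      using that by (intro sum.cong refl) auto
    finally show ?thesis using that by simp
  qed
  have "(U * diag_real d ev * adj U) $$ (i,j) = (\<Sum>k<d. (U * diag_real d ev) $$ (i,k) * adj U $$ (k,j))"
    by (rule index_mult_mat_sum) (use U ij in auto)
  also have "\<dots> = (\<Sum>k<d. complex_of_real (ev k) * U $$ (i,k) * cnj (U $$ (j,k)))"
    using U ij by (intro sum.cong refl) (simp add: UD del: index_mult_mat)
  finally show ?thesis .
qed

lemma hermitian_conj:
  assumes A: "hermitian n A" and W: "W \<in> carrier_mat n n"
  shows "hermitian n (adj W * A * W)"
proof -
  have A': "A \<in> carrier_mat n n" "adj A = A" using A by (auto simp: hermitian_def)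
  have "adj (adj W * A * W) = adj W * (adj A * adj (adj W))"
    using A' W by (simp add: adj_mult[of _ n n _ n])
  then show ?thesis using A' W
    by (simp add: hermitian_def assoc_mult_mat[of _ n n _ n _ n])
qed

text \<open>Deflation: conjugating by a unitary whose first column is an eigenvector clears the
  first column off the diagonal, hermiticity clears the first row as well, and the remaining block
  is Hermitian of size \<open>n\<close>, so the induction hypothesis diagonalises it.\<close>

theorem hermitian_spectral:
  assumes "hermitian n A"
  shows "\<exists>U ev. unitary n U \<and> A = U * diag_real n ev * adj U"
  using assms
proof (induction n arbitrary: A)
  case 0
  then have "A \<in> carrier_mat 0 0" by (simp add: hermitian_def)
  moreover have "unitary 0 (1\<^sub>m 0)" by (auto simp: unitary_def intro!: eq_matI)
  ultimately show ?case
    by (intro exI[of _ "1\<^sub>m 0"] exI[of _ "\<lambda>_. 0"]) (auto intro!: eq_matI)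
next
  case (Suc n)
  let ?N = "Suc n"
  have A: "A \<in> carrier_mat ?N ?N" using Suc.prems by (simp add: hermitian_def)
  obtain e where "e \<in> spectrum A" using spectrum_non_empty[OF A] by auto
  then obtain v where "eigenvector A v e" by (auto simp: spectrum_def eigenvalue_def)
  then have v: "v \<in> carrier_vec ?N" "v \<noteq> 0\<^sub>v ?N" and Av: "A *\<^sub>v v = e \<cdot>\<^sub>v v"
    using A by (auto simp: eigenvector_def)
  obtain W c where W: "unitary ?N W" and W0: "\<And>i. i < ?N \<Longrightarrow> W $$ (i,0) = c * v $ i"
    using unitary_with_first_column[OF v] by blast
  have Wc: "W \<in> carrier_mat ?N ?N" and WW: "adj W * W = 1\<^sub>m ?N" "W * adj W = 1\<^sub>m ?N"
    using W by (auto simp: unitary_def)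
  define B where "B = adj W * A * W"
  have B: "hermitian ?N B" unfolding B_def using hermitian_conj[OF Suc.prems Wc] .
  have Bc: "B \<in> carrier_mat ?N ?N" using B by (simp add: hermitian_def)
  have AW0: "(A * W) $$ (k,0) = e * W $$ (k,0)" if "k < ?N" for k
  proof -
    have "(A * W) $$ (k,0) = (\<Sum>l<?N. A $$ (k,l) * W $$ (l,0))"
      by (rule index_mult_mat_sum) (use A Wc that in auto)
    also have "\<dots> = c * (\<Sum>l<?N. A $$ (k,l) * v $ l)"
      unfolding sum_distrib_left by (intro sum.cong refl) (simp add: W0)
    also have "(\<Sum>l<?N. A $$ (k,l) * v $ l) = (A *\<^sub>v v) $ k"
      using A v that by (simp add: scalar_prod_def lessThan_atLeast0)
    also have "\<dots> = e * v $ k" using v that by (simp add: Av)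
    finally show ?thesis using W0[OF that] by simp
  qed
  have B0: "B $$ (i,0) = (if i = 0 then e else 0)" if "i < ?N" for i
  proof -
    have "B = adj W * (A * W)" unfolding B_def
      by (rule assoc_mult_mat[of _ ?N ?N _ ?N _ ?N]) (use A Wc in auto)
    then have "B $$ (i,0) = (\<Sum>k<?N. adj W $$ (i,k) * (A * W) $$ (k,0))"
      using index_mult_mat_sum[of "adj W" ?N ?N "A * W" ?N i 0] A Wc that by simp
    also have "\<dots> = e * (\<Sum>k<?N. adj W $$ (i,k) * W $$ (k,0))"
      unfolding sum_distrib_left by (intro sum.cong refl) (simp add: AW0 del: index_mult_mat)
    also have "(\<Sum>k<?N. adj W $$ (i,k) * W $$ (k,0)) = (adj W * W) $$ (i,0)"
      by (rule index_mult_mat_sum[symmetric]) (use Wc that in auto)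
    finally show ?thesis using that WW by simp
  qed
  have Bherm: "B $$ (i,j) = cnj (B $$ (j,i))" if "i < ?N" "j < ?N" for i j
    using B that unfolding hermitian_iff by blast
  \<comment> \<open>The eigenvalue is a diagonal entry of the Hermitian matrix \<open>B\<close>,
    hence real.\<close>
  have "cnj e = e"
    using Bherm[OF zero_less_Suc zero_less_Suc] unfolding B0[OF zero_less_Suc] by simp
  then have e_real: "complex_of_real (Re e) = e"
    by (simp add: complex_eq_iff)
  have B0': "B $$ (0,j) = (if j = 0 then e else 0)" if "j < ?N" for j
    using \<open>cnj e = e\<close> unfolding Bherm[OF zero_less_Suc that] B0[OF that] by simp
  define A3 where "A3 = mat n n (\<lambda>(i,j). B $$ (Suc i, Suc j))"
  have "hermitian n A3"
    unfolding hermitian_iff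
  proof (intro conjI allI impI)
    fix i j assume "i < n" "j < n"
    then have s: "A3 $$ (i,j) = B $$ (Suc i, Suc j)" "A3 $$ (j,i) = B $$ (Suc j, Suc i)"
      "Suc i < ?N" "Suc j < ?N" by (simp_all add: A3_def)
    show "A3 $$ (i,j) = cnj (A3 $$ (j,i))" unfolding s(1,2) by (rule Bherm[OF s(3,4)])
  qed (simp add: A3_def)
  then obtain V ev where V: "unitary n V" and A3: "A3 = V * diag_real n ev * adj V"
    using Suc.IH by blast
  have Vc: "V \<in> carrier_mat n n" and VV: "adj V * V = 1\<^sub>m n" using V by (auto simp: unitary_def)
  \<comment> \<open>\<open>V'\<close> is the direct sum of the 1-by-1 identity and \<open>V\<close>;
    \<open>ev'\<close> puts the eigenvalue split off above in front of those of the block.\<close>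
  define V' where "V' = mat ?N ?N (\<lambda>(i,j). case i of 0 \<Rightarrow> (if j = 0 then 1 else 0)
      | Suc i' \<Rightarrow> (case j of 0 \<Rightarrow> 0 | Suc j' \<Rightarrow> V $$ (i',j')))"
  define ev' where "ev' = (\<lambda>i. case i of 0 \<Rightarrow> Re e | Suc i' \<Rightarrow> ev i')"
  have V'c: "V' \<in> carrier_mat ?N ?N" by (simp add: V'_def)
  have "adj V' * V' = 1\<^sub>m ?N"
  proof (rule eq_matI)
    fix i j assume "i < dim_row (1\<^sub>m ?N :: complex mat)" "j < dim_col (1\<^sub>m ?N :: complex mat)"
    then have ij: "i < ?N" "j < ?N" by auto
    have "(adj V' * V') $$ (i,j) = (\<Sum>k<?N. adj V' $$ (i,k) * V' $$ (k,j))"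
      by (rule index_mult_mat_sum) (use V'c ij in auto)
    also have "\<dots> = (\<Sum>k<?N. cnj (V' $$ (k,i)) * V' $$ (k,j))"
      using V'c ij by (intro sum.cong refl) simp
    also have "\<dots> = cnj (V' $$ (0,i)) * V' $$ (0,j) + (\<Sum>k<n. cnj (V' $$ (Suc k,i)) * V' $$ (Suc k,j))"
      by (rule sum.lessThan_Suc_shift)
    also have "\<dots> = 1\<^sub>m ?N $$ (i,j)"
    proof (cases i; cases j)
      fix i' j' assume s: "i = Suc i'" "j = Suc j'"
      have "(\<Sum>k<n. cnj (V' $$ (Suc k,i)) * V' $$ (Suc k,j)) = (\<Sum>k<n. adj V $$ (i',k) * V $$ (k,j'))"
        using s ij Vc by (intro sum.cong refl) (simp add: V'_def)
      also have "\<dots> = (adj V * V) $$ (i',j')"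
        by (rule index_mult_mat_sum[symmetric]) (use Vc s ij in auto)
      finally show ?thesis using s ij VV by (simp add: V'_def)
    qed (use ij in \<open>auto simp: V'_def\<close>)
    finally show "(adj V' * V') $$ (i,j) = 1\<^sub>m ?N $$ (i,j)" .
  qed (use V'c in auto)
  then have V': "unitary ?N V'" using V'c by (rule unitary_of_isometry[rotated])
  have BV: "B = V' * diag_real ?N ev' * adj V'"
  proof (rule eq_matI)
    fix i j assume "i < dim_row (V' * diag_real ?N ev' * adj V')" "j < dim_col (V' * diag_real ?N ev' * adj V')"
    then have ij: "i < ?N" "j < ?N" using V'c by auto
    have "(V' * diag_real ?N ev' * adj V') $$ (i,j) =
        (\<Sum>k<?N. complex_of_real (ev' k) * V' $$ (i,k) * cnj (V' $$ (j,k)))"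
      by (rule conj_diag_index) (use V'c ij in auto)
    also have "\<dots> = complex_of_real (Re e) * V' $$ (i,0) * cnj (V' $$ (j,0)) +
        (\<Sum>k<n. complex_of_real (ev k) * V' $$ (i,Suc k) * cnj (V' $$ (j,Suc k)))"
      by (subst sum.lessThan_Suc_shift) (simp add: ev'_def)
    also have "\<dots> = B $$ (i,j)"
    proof (cases i; cases j)
      fix i' j' assume s: "i = Suc i'" "j = Suc j'"
      have "(\<Sum>k<n. complex_of_real (ev k) * V' $$ (i,Suc k) * cnj (V' $$ (j,Suc k))) =
          (\<Sum>k<n. complex_of_real (ev k) * V $$ (i',k) * cnj (V $$ (j',k)))"
        using s ij Vc by (intro sum.cong refl) (simp add: V'_def)
      also have "\<dots> = A3 $$ (i',j')"
        unfolding A3 by (rule conj_diag_index[symmetric]) (use Vc s ij in auto)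
      finally show ?thesis using s ij by (simp add: V'_def A3_def)
    qed (use ij B0 B0' e_real in \<open>auto simp: V'_def\<close>)
    finally show "B $$ (i,j) = (V' * diag_real ?N ev' * adj V') $$ (i,j)" by simp
  qed (use V'c Bc in auto)
  have c: "adj W \<in> carrier_mat ?N ?N" "adj V' \<in> carrier_mat ?N ?N" "diag_real ?N ev' \<in> carrier_mat ?N ?N"
    using Wc V'c by auto
  have "W * B * adj W = (W * adj W) * A * (W * adj W)"
    unfolding B_def using A Wc c by (simp add: assoc_mult_mat[of _ ?N ?N _ ?N _ ?N])
  also have "\<dots> = A" using A by (simp add: WW)
  finally have "A = W * B * adj W" by simp
  also have "\<dots> = (W * V') * diag_real ?N ev' * adj (W * V')"
    unfolding BV adj_mult[OF Wc V'c] using Wc V'c c by (simp add: assoc_mult_mat[of _ ?N ?N _ ?N _ ?N])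
  finally show ?case using unitary_mult[OF W V'] by blast
qed

section \<open>Quadratic forms, traces and effects\<close>

text \<open>Vectors are plain functions of which only the first \<open>d\<close> values are read.
  This removes dimension side conditions on vectors and lets them inherit the pointwise group
  structure used for the abstract measurement bound.\<close>

definition qform :: "nat \<Rightarrow> complex mat \<Rightarrow> (nat \<Rightarrow> complex) \<Rightarrow> complex" where
  "qform d A f = (\<Sum>i<d. \<Sum>j<d. cnj (f i) * A $$ (i,j) * f j)"

definition sqnorm :: "nat \<Rightarrow> (nat \<Rightarrow> complex) \<Rightarrow> real" where
  "sqnorm d f = (\<Sum>i<d. (cmod (f i))\<^sup>2)"

lemma of_real_sqnorm: "complex_of_real (sqnorm d f) = (\<Sum>i<d. cnj (f i) * f i)"
  unfolding sqnorm_def of_real_sum complex_norm_square by (simp add: mult.commute)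

lemma sqnorm_nonneg [simp]: "0 \<le> sqnorm d f"
  by (simp add: sqnorm_def sum_nonneg)

lemma psd_iff: "psd d A \<longleftrightarrow> hermitian d A \<and> (\<forall>f. 0 \<le> Re (qform d A f))"
proof -
  have *: "(\<Sum>i<d. cnj (v $ i) * (A *\<^sub>v v) $ i) = qform d A (\<lambda>i. v $ i)"
    if "A \<in> carrier_mat d d" "v \<in> carrier_vec d" for v
    unfolding qform_def using that
    by (intro sum.cong refl) (simp add: scalar_prod_def lessThan_atLeast0 sum_distrib_left mult.assoc)
  have **: "qform d A f = qform d A (\<lambda>i. vec d f $ i)" for f
    unfolding qform_def by (intro sum.cong refl) simp
  have "(\<forall>v\<in>carrier_vec d. 0 \<le> Re (\<Sum>i<d. cnj (v $ i) * (A *\<^sub>v v) $ i)) \<longleftrightarrow> (\<forall>f. 0 \<le> Re (qform d A f))"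
    if A: "A \<in> carrier_mat d d"
  proof
    assume l: "\<forall>v\<in>carrier_vec d. 0 \<le> Re (\<Sum>i<d. cnj (v $ i) * (A *\<^sub>v v) $ i)"
    show "\<forall>f. 0 \<le> Re (qform d A f)"
    proof
      fix f show "0 \<le> Re (qform d A f)"
        using bspec[OF l vec_carrier[of d f]] unfolding *[OF A vec_carrier] **[symmetric] .
    qed
  qed (use * A in auto)
  then show ?thesis by (auto simp: psd_def hermitian_def)
qed

lemma psd_carrier: "psd d A \<Longrightarrow> A \<in> carrier_mat d d"
  by (simp add: psd_def hermitian_def)

lemma psdD: "psd d A \<Longrightarrow> 0 \<le> Re (qform d A f)"
  by (simp add: psd_iff)

lemma qform_one: "qform d (1\<^sub>m d) f = complex_of_real (sqnorm d f)"
proof -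
  have "qform d (1\<^sub>m d) f = (\<Sum>i<d. \<Sum>j<d. if j = i then cnj (f i) * f i else 0)"
    unfolding qform_def by (intro sum.cong refl) auto
  also have "\<dots> = (\<Sum>i<d. cnj (f i) * f i)"
    by (intro sum.cong refl) simp
  finally show ?thesis by (simp add: of_real_sqnorm)
qed

lemma qform_minus:
  assumes "A \<in> carrier_mat d d" "B \<in> carrier_mat d d"
  shows "qform d (A - B) f = qform d A f - qform d B f"
proof -
  have "qform d (A - B) f = (\<Sum>i<d. \<Sum>j<d. cnj (f i) * A $$ (i,j) * f j - cnj (f i) * B $$ (i,j) * f j)"
    unfolding qform_def using assms by (intro sum.cong refl) (simp add: algebra_simps)
  then show ?thesis by (simp add: qform_def sum_subtractf)
qed

lemma hermitian_minus:
  assumes "hermitian d A" "hermitian d B"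
  shows "hermitian d (A - B)"
proof -
  have c: "A \<in> carrier_mat d d" "B \<in> carrier_mat d d" using assms by (auto simp: hermitian_def)
  show ?thesis
    unfolding hermitian_iff
  proof (intro conjI allI impI)
    fix i j assume ij: "i < d" "j < d"
    have "A $$ (i,j) = cnj (A $$ (j,i))" "B $$ (i,j) = cnj (B $$ (j,i))"
      using assms ij unfolding hermitian_iff by blast+
    then show "(A - B) $$ (i,j) = cnj ((A - B) $$ (j,i))"
      using c ij by simp
  qed (use c in \<open>simp add: minus_carrier_mat\<close>)
qed

lemma hermitian_one [simp]: "hermitian d (1\<^sub>m d)"
  by (auto simp: hermitian_iff)

lemma sum_swap3: "(\<Sum>i<a. \<Sum>j<b. \<Sum>k<c. f i j k) = (\<Sum>k<c. \<Sum>i<a. \<Sum>j<b. f i j k)"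
  for f :: "nat \<Rightarrow> nat \<Rightarrow> nat \<Rightarrow> 'a::comm_monoid_add"
proof -
  have "(\<Sum>i<a. \<Sum>j<b. \<Sum>k<c. f i j k) = (\<Sum>i<a. \<Sum>k<c. \<Sum>j<b. f i j k)"
    by (rule sum.cong[OF refl], rule sum.swap)
  also have "\<dots> = (\<Sum>k<c. \<Sum>i<a. \<Sum>j<b. f i j k)" by (rule sum.swap)
  finally show ?thesis .
qed

text \<open>For a weighted sum of rank-one matrices \<open>u k\<close> times its adjoint, the
  quadratic form is the weighted sum of squared overlaps of \<open>f\<close> with the
  \<open>u k\<close>.\<close>

lemma qform_of_gram:
  fixes n :: nat
  assumes "\<And>i j. i < d \<Longrightarrow> j < d \<Longrightarrow> A $$ (i,j) = (\<Sum>k<n. complex_of_real (w k) * u k i * cnj (u k j))"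
  shows "qform d A f = complex_of_real (\<Sum>k<n. w k * (cmod (\<Sum>i<d. cnj (u k i) * f i))\<^sup>2)"
proof -
  have "qform d A f = (\<Sum>i<d. \<Sum>j<d. \<Sum>k<n. complex_of_real (w k) * (cnj (f i) * u k i) * (cnj (u k j) * f j))"
    unfolding qform_def by (intro sum.cong refl) (simp add: assms sum_distrib_left sum_distrib_right algebra_simps)
  also have "\<dots> = (\<Sum>k<n. \<Sum>i<d. \<Sum>j<d. complex_of_real (w k) * (cnj (f i) * u k i) * (cnj (u k j) * f j))"
    by (rule sum_swap3)
  also have "\<dots> = (\<Sum>k<n. complex_of_real (w k) * ((\<Sum>j<d. cnj (u k j) * f j) * cnj (\<Sum>i<d. cnj (u k i) * f i)))"
  proof (intro sum.cong refl)
    fix k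
    have "(\<Sum>i<d. \<Sum>j<d. complex_of_real (w k) * (cnj (f i) * u k i) * (cnj (u k j) * f j)) =
        complex_of_real (w k) * ((\<Sum>i<d. cnj (f i) * u k i) * (\<Sum>j<d. cnj (u k j) * f j))"
      by (subst sum_product) (simp add: sum_distrib_left mult.assoc)
    also have "(\<Sum>i<d. cnj (f i) * u k i) = cnj (\<Sum>i<d. cnj (u k i) * f i)"
      by (simp add: mult.commute)
    finally show "(\<Sum>i<d. \<Sum>j<d. complex_of_real (w k) * (cnj (f i) * u k i) * (cnj (u k j) * f j)) =
        complex_of_real (w k) * ((\<Sum>j<d. cnj (u k j) * f j) * cnj (\<Sum>i<d. cnj (u k i) * f i))"
      by (simp add: mult.commute)
  qed
  also have "\<dots> = complex_of_real (\<Sum>k<n. w k * (cmod (\<Sum>i<d. cnj (u k i) * f i))\<^sup>2)"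
    unfolding complex_norm_square[symmetric] by simp
  finally show ?thesis .
qed

lemma hermitian_of_gram:
  fixes n :: nat
  assumes "A \<in> carrier_mat d d"
    and "\<And>i j. i < d \<Longrightarrow> j < d \<Longrightarrow> A $$ (i,j) = (\<Sum>k<n. complex_of_real (w k) * u k i * cnj (u k j))"
  shows "hermitian d A"
  unfolding hermitian_iff
proof (intro conjI allI impI)
  fix i j assume ij: "i < d" "j < d"
  show "A $$ (i,j) = cnj (A $$ (j,i))"
    unfolding assms(2)[OF ij] assms(2)[OF ij(2,1)] by (simp add: mult.assoc mult.commute mult.left_commute)
qed fact

lemma qform_conj_diag:
  assumes "U \<in> carrier_mat d d"
  shows "qform d (U * diag_real d ev * adj U) f =
    complex_of_real (\<Sum>k<d. ev k * (cmod (\<Sum>i<d. cnj (U $$ (i,k)) * f i))\<^sup>2)"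
  by (rule qform_of_gram) (rule conj_diag_index[OF assms])

lemma psd_conj_diag:
  assumes "U \<in> carrier_mat d d" "\<And>k. k < d \<Longrightarrow> 0 \<le> ev k"
  shows "psd d (U * diag_real d ev * adj U)"
proof -
  note i = conj_diag_index[OF assms(1), of _ _ ev]
  have h: "hermitian d (U * diag_real d ev * adj U)"
    by (rule hermitian_of_gram[where u = "\<lambda>k i. U $$ (i,k)"]) (use assms i in auto)
  have "0 \<le> Re (qform d (U * diag_real d ev * adj U) f)" for f
    unfolding qform_conj_diag[OF assms(1)] using assms(2) by (auto intro!: sum_nonneg)
  then show ?thesis using h by (simp add: psd_iff)
qed

lemma unitary_columns:
  assumes "unitary d U" "k < d" "l < d"
  shows "(\<Sum>i<d. cnj (U $$ (i,k)) * U $$ (i,l)) = (if k = l then 1 else 0)"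
proof -
  have U: "U \<in> carrier_mat d d" "adj U * U = 1\<^sub>m d" using assms by (auto simp: unitary_def)
  have "(\<Sum>i<d. cnj (U $$ (i,k)) * U $$ (i,l)) = (\<Sum>i<d. adj U $$ (k,i) * U $$ (i,l))"
    using U assms by (intro sum.cong refl) simp
  also have "\<dots> = (adj U * U) $$ (k,l)"
    by (rule index_mult_mat_sum[symmetric]) (use U assms in auto)
  finally show ?thesis using U assms by simp
qed

text \<open>Orthonormality of the columns leaves a single term. Evaluating the form at a column
  therefore reads off an eigenvalue, which shows that the eigenvalues of a positive matrix are
  nonnegative.\<close>

lemma qform_conj_diag_column:
  assumes U: "unitary d U" and k: "k < d"
  shows "qform d (U * diag_real d ev * adj U) (\<lambda>i. U $$ (i,k)) = complex_of_real (ev k)"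
proof -
  have Uc: "U \<in> carrier_mat d d" using U by (simp add: unitary_def)
  have "(\<Sum>l<d. ev l * (cmod (\<Sum>i<d. cnj (U $$ (i,l)) * U $$ (i,k)))\<^sup>2) = (\<Sum>l<d. if l = k then ev k else 0)"
    by (intro sum.cong refl) (use unitary_columns[OF U] k in auto)
  then show ?thesis unfolding qform_conj_diag[OF Uc] using k by simp
qed

text \<open>The vectors are the eigenvector columns scaled by the square roots of their
  eigenvalues.\<close>

lemma psd_gram:
  assumes "psd d A"
  obtains u where "\<And>i j. i < d \<Longrightarrow> j < d \<Longrightarrow> A $$ (i,j) = (\<Sum>k<d. u k i * cnj (u k j))"
proof -
  obtain U ev where U: "unitary d U" and A: "A = U * diag_real d ev * adj U"
    using hermitian_spectral[of d A] assms by (auto simp: psd_def)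
  have Uc: "U \<in> carrier_mat d d" using U by (simp add: unitary_def)
  have ev: "0 \<le> ev k" if "k < d" for k
    using psdD[OF assms] qform_conj_diag_column[OF U that, of ev] A by (metis Re_complex_of_real)
  define u where "u k i = complex_of_real (sqrt (ev k)) * U $$ (i,k)" for k i
  have "A $$ (i,j) = (\<Sum>k<d. u k i * cnj (u k j))" if "i < d" "j < d" for i j
  proof -
    have "A $$ (i,j) = (\<Sum>k<d. complex_of_real (ev k) * U $$ (i,k) * cnj (U $$ (j,k)))"
      unfolding A by (rule conj_diag_index[OF Uc that])
    also have "\<dots> = (\<Sum>k<d. u k i * cnj (u k j))"
    proof (intro sum.cong refl)
      fix k assume "k \<in> {..<d}"
      then have "complex_of_real (ev k) = complex_of_real (sqrt (ev k)) * complex_of_real (sqrt (ev k))"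
        using ev[of k] by (simp flip: of_real_mult)
      then show "complex_of_real (ev k) * U $$ (i,k) * cnj (U $$ (j,k)) = u k i * cnj (u k j)"
        by (simp add: u_def)
    qed
    finally show ?thesis .
  qed
  then show ?thesis by (rule that)
qed

section \<open>Traces of products with positive matrices\<close>

lemma mtrace_mult:
  assumes "A \<in> carrier_mat d d" "B \<in> carrier_mat d d"
  shows "mtrace (A * B) = (\<Sum>i<d. \<Sum>j<d. A $$ (i,j) * B $$ (j,i))"
proof -
  have "mtrace (A * B) = (\<Sum>i<d. (A * B) $$ (i,i))" using assms by (simp add: mtrace_def)
  also have "\<dots> = (\<Sum>i<d. \<Sum>j<d. A $$ (i,j) * B $$ (j,i))"
    using assms by (intro sum.cong refl index_mult_mat_sum) auto
  finally show ?thesis .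
qed

lemma mtrace_mult_gram:
  fixes n :: nat
  assumes c: "A \<in> carrier_mat d d" "B \<in> carrier_mat d d"
    and g: "\<And>i j. i < d \<Longrightarrow> j < d \<Longrightarrow> A $$ (i,j) = (\<Sum>k<n. w k * u k i * cnj (u k j))"
  shows "mtrace (A * B) = (\<Sum>k<n. w k * qform d B (u k))"
proof -
  have "mtrace (A * B) = (\<Sum>i<d. \<Sum>j<d. \<Sum>k<n. w k * (cnj (u k j) * B $$ (j,i) * u k i))"
    unfolding mtrace_mult[OF c]
    by (intro sum.cong refl) (simp add: g sum_distrib_left sum_distrib_right algebra_simps)
  also have "\<dots> = (\<Sum>k<n. \<Sum>i<d. \<Sum>j<d. w k * (cnj (u k j) * B $$ (j,i) * u k i))"
    by (rule sum_swap3)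
  also have "\<dots> = (\<Sum>k<n. \<Sum>j<d. \<Sum>i<d. w k * (cnj (u k j) * B $$ (j,i) * u k i))"
    by (intro sum.cong refl sum.swap)
  also have "\<dots> = (\<Sum>k<n. w k * qform d B (u k))"
    by (simp add: qform_def sum_distrib_left)
  finally show ?thesis .
qed

text \<open>The vectors come from \<open>psd_gram\<close> and do not depend on \<open>B\<close>. Any
  inequality between quadratic forms thus passes to traces against a positive matrix by summing it
  over these vectors.\<close>

lemma psd_trace_qform:
  assumes "psd d A"
  obtains u where "\<And>B. B \<in> carrier_mat d d \<Longrightarrow> mtrace (A * B) = (\<Sum>k<d. qform d B (u k))"
proof -
  obtain u where u: "\<And>i j. i < d \<Longrightarrow> j < d \<Longrightarrow> A $$ (i,j) = (\<Sum>k<d. u k i * cnj (u k j))"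
    using psd_gram[OF assms] by blast
  show ?thesis
    by (rule that[of u])
       (use mtrace_mult_gram[OF psd_carrier[OF assms], where n = d and w = "\<lambda>_. 1" and u = u] u in auto)
qed

lemma mtrace_commute:
  assumes "A \<in> carrier_mat d d" "B \<in> carrier_mat d d"
  shows "mtrace (A * B) = mtrace (B * A)"
  unfolding mtrace_mult[OF assms] mtrace_mult[OF assms(2,1)]
  by (subst sum.swap) (simp add: mult.commute)

lemma mtrace_mult_nonneg:
  assumes "psd d A" "psd d B"
  shows "0 \<le> Re (mtrace (A * B))"
proof -
  obtain u where u: "\<And>B. B \<in> carrier_mat d d \<Longrightarrow> mtrace (A * B) = (\<Sum>k<d. qform d B (u k))"
    using psd_trace_qform[OF assms(1)] by blast
  show ?thesis using u[OF psd_carrier[OF assms(2)]] psdD[OF assms(2)] by (simp add: sum_nonneg)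
qed

section \<open>Effects and the optimal test\<close>

definition effect :: "nat \<Rightarrow> complex mat \<Rightarrow> bool" where
  "effect d T \<longleftrightarrow> psd d T \<and> psd d (1\<^sub>m d - T)"

lemma effect_iff:
  "effect d T \<longleftrightarrow> hermitian d T \<and> (\<forall>f. 0 \<le> Re (qform d T f) \<and> Re (qform d T f) \<le> sqnorm d f)"
proof -
  have "Re (qform d (1\<^sub>m d - T) f) = sqnorm d f - Re (qform d T f)" if "T \<in> carrier_mat d d" for f
    using that by (simp add: qform_minus qform_one)
  then show ?thesis
    using hermitian_minus[OF hermitian_one, of d T]
    by (auto simp: effect_def psd_iff hermitian_def[of d T])
qed

lemma mtrace_mult_effect_le:
  assumes "psd d A" "effect d T"
  shows "Re (mtrace (A * T)) \<le> Re (mtrace A)"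
proof -
  obtain u where u: "\<And>B. B \<in> carrier_mat d d \<Longrightarrow> mtrace (A * B) = (\<Sum>k<d. qform d B (u k))"
    using psd_trace_qform[OF assms(1)] by blast
  have A: "A \<in> carrier_mat d d" using assms(1) by (rule psd_carrier)
  have T: "T \<in> carrier_mat d d" using assms by (simp add: effect_def psd_carrier)
  have "Re (mtrace (A * T)) \<le> (\<Sum>k<d. sqnorm d (u k))"
    using assms(2) by (auto simp: u[OF T] effect_iff intro!: sum_mono)
  also have "\<dots> = Re (mtrace (A * 1\<^sub>m d))" by (simp add: u qform_one)
  finally show ?thesis using A by simp
qed

lemma mtrace_mult_conj_diag:
  assumes U: "U \<in> carrier_mat d d" and T: "T \<in> carrier_mat d d"
  shows "mtrace (T * (U * diag_real d ev * adj U)) = (\<Sum>k<d. complex_of_real (ev k) * qform d T (\<lambda>i. U $$ (i,k)))"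
proof -
  have c: "U * diag_real d ev * adj U \<in> carrier_mat d d" using U by simp
  show ?thesis unfolding mtrace_commute[OF T c]
    by (rule mtrace_mult_gram) (use c T conj_diag_index[OF U, of _ _ ev] in auto)
qed

text \<open>The quantum Neyman-Pearson principle. In an eigenbasis of \<open>A\<close> the trace of
  \<open>T * A\<close> is the sum of the eigenvalues weighted by numbers in [0,1], and it is largest
  when weight 1 goes to exactly the nonnegative eigenvalues, which is what the projection
  does.\<close>

lemma nonneg_proj_optimal:
  assumes "hermitian d A"
  shows "effect d (nonneg_proj d A)"
    and "effect d T \<Longrightarrow> Re (mtrace (T * A)) \<le> Re (mtrace (nonneg_proj d A * A))"
proof -
  let ?Q = "\<lambda>(U, ev). unitary d U \<and> A = U * diag_real d ev * adj U"
  \<comment> \<open>The whole argument runs in the decomposition that \<open>SOME\<close> selects in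
    \<open>nonneg_proj\<close>; the spectral theorem guarantees that the selected pair is a genuine
    one.\<close>
  obtain U ev where Uev: "(SOME z. ?Q z) = (U, ev)" by fastforce
  have "\<exists>z. ?Q z" using hermitian_spectral[OF assms] by auto
  then have "?Q (SOME z. ?Q z)" by (rule someI_ex)
  then have U: "unitary d U" and A: "A = U * diag_real d ev * adj U" by (auto simp: Uev)
  define \<pi> where "\<pi> = (\<lambda>i. if 0 \<le> ev i then 1 else 0 :: real)"
  define P where "P = U * diag_real d \<pi> * adj U"
  have "nonneg_proj d A = U * mat d d (\<lambda>(i,j). if i = j \<and> 0 \<le> ev i then 1 else 0) * adj U"
    using Uev unfolding nonneg_proj_def diag_real_def by (simp add: case_prod_beta')
  also have "mat d d (\<lambda>(i,j). if i = j \<and> 0 \<le> ev i then 1 else 0) = diag_real d \<pi>"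
    by (intro eq_matI) (auto simp: \<pi>_def)
  finally have P: "nonneg_proj d A = P" by (simp add: P_def)
  have Uc: "U \<in> carrier_mat d d" using U by (simp add: unitary_def)
  have Pc: "P \<in> carrier_mat d d" using Uc by (simp add: P_def)
  have one: "U * diag_real d (\<lambda>_. 1) * adj U = 1\<^sub>m d"
  proof -
    have "diag_real d (\<lambda>_. 1) = 1\<^sub>m d" by (intro eq_matI) auto
    then show ?thesis using U Uc by (simp add: unitary_def)
  qed
  have "1\<^sub>m d - P = U * diag_real d (\<lambda>k. 1 - \<pi> k) * adj U"
  proof (rule eq_matI)
    fix i j assume "i < dim_row (U * diag_real d (\<lambda>k. 1 - \<pi> k) * adj U)" "j < dim_col (U * diag_real d (\<lambda>k. 1 - \<pi> k) * adj U)"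
    then have ij: "i < d" "j < d" using Uc by auto
    have "(1\<^sub>m d - P) $$ (i,j) = (U * diag_real d (\<lambda>_. 1) * adj U) $$ (i,j) - P $$ (i,j)"
      using ij Pc one by simp
    also have "\<dots> = (U * diag_real d (\<lambda>k. 1 - \<pi> k) * adj U) $$ (i,j)"
      unfolding P_def conj_diag_index[OF Uc ij] by (simp add: algebra_simps sum_subtractf)
    finally show "(1\<^sub>m d - P) $$ (i,j) = (U * diag_real d (\<lambda>k. 1 - \<pi> k) * adj U) $$ (i,j)" .
  qed (use Uc Pc in auto)
  moreover have "psd d (U * diag_real d (\<lambda>k. 1 - \<pi> k) * adj U)" "psd d P"
    unfolding P_def by (rule psd_conj_diag[OF Uc]; simp add: \<pi>_def)+
  ultimately show "effect d (nonneg_proj d A)" by (simp add: P effect_def)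
  assume T: "effect d T"
  then have Tc: "T \<in> carrier_mat d d" by (simp add: effect_def psd_carrier)
  have "Re (mtrace (T * A)) = (\<Sum>k<d. ev k * Re (qform d T (\<lambda>i. U $$ (i,k))))"
    unfolding A mtrace_mult_conj_diag[OF Uc Tc] by simp
  also have "\<dots> \<le> (\<Sum>k<d. ev k * \<pi> k)"
  proof (rule sum_mono)
    fix k assume "k \<in> {..<d}"
    then have k: "k < d" by simp
    let ?t = "Re (qform d T (\<lambda>i. U $$ (i,k)))"
    have "complex_of_real (sqnorm d (\<lambda>i. U $$ (i,k))) = 1"
      unfolding of_real_sqnorm using unitary_columns[OF U k k] by simp
    then have "sqnorm d (\<lambda>i. U $$ (i,k)) = 1" by simp
    then have t: "0 \<le> ?t" "?t \<le> 1" using T unfolding effect_iff by metis+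
    show "ev k * ?t \<le> ev k * \<pi> k"
    proof (cases "0 \<le> ev k")
      case True
      then show ?thesis using mult_left_mono[OF t(2) True] by (simp add: \<pi>_def)
    next
      case False
      then show ?thesis using t(1) by (simp add: \<pi>_def mult_nonpos_nonneg)
    qed
  qed
  also have "\<dots> = Re (mtrace (P * A))"
    unfolding A mtrace_mult_conj_diag[OF Uc Pc]
    by (simp add: P_def qform_conj_diag_column[OF U])
  finally show "Re (mtrace (T * A)) \<le> Re (mtrace (nonneg_proj d A * A))" by (simp add: P)
qed

section \<open>Measurement and codebook\<close>

locale semi_inner_product =
  fixes ip :: "'v::ab_group_add \<Rightarrow> 'v \<Rightarrow> real"
  assumes ip_add_left: "ip (x + y) z = ip x z + ip y z"
    and ip_sym: "ip x y = ip y x"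
    and ip_nonneg: "0 \<le> ip x x"
begin

lemma ip_add_right: "ip x (y + z) = ip x y + ip x z"
  using ip_add_left[of y z x] by (simp add: ip_sym)

lemma ip_diff_left: "ip (x - y) z = ip x z - ip y z"
  using ip_add_left[of "x - y" y z] by simp

lemma ip_diff_right: "ip x (y - z) = ip x y - ip x z"
  using ip_diff_left[of y z x] by (simp add: ip_sym)

lemmas ip_simps = ip_add_left ip_add_right ip_diff_left ip_diff_right

text \<open>The intended form is the real part of the inner product of the first \<open>d\<close>
  coordinates, which is symmetric but degenerate on functions. The vectors carry only a group
  structure, so linearity appears as additivity and a doubling is written as a sum.\<close>

definition positive :: "('v \<Rightarrow> 'v) \<Rightarrow> bool" where
  "positive A \<longleftrightarrow> (\<forall>x y. A (x + y) = A x + A y) \<and> (\<forall>x y. ip (A x) y = ip x (A y)) \<and> (\<forall>x. 0 \<le> ip x (A x))"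

lemma positive_add: "positive A \<Longrightarrow> A (x + y) = A x + A y"
  and positive_sym: "positive A \<Longrightarrow> ip (A x) y = ip x (A y)"
  and positive_nonneg: "positive A \<Longrightarrow> 0 \<le> ip x (A x)"
  by (auto simp: positive_def)

lemma positive_diff: "positive A \<Longrightarrow> A (x - y) = A x - A y"
  using positive_add[of A "x - y" y] by simp

text \<open>Parallelogram law: the forms at \<open>x + y\<close> and \<open>x - y\<close> add up to
  the right-hand side and both are nonnegative.\<close>

lemma positive_add_le:
  assumes "positive A"
  shows "ip (x + y) (A (x + y)) \<le> 2 * ip x (A x) + 2 * ip y (A y)"
    and "ip (x - y) (A (x - y)) \<le> 2 * ip x (A x) + 2 * ip y (A y)"
proof -
  have s: "ip y (A x) = ip x (A y)"
    using positive_sym[OF assms, of x y] ip_sym[of "A x" y] by simp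
  have "0 \<le> ip (x - y) (A (x - y))" "0 \<le> ip (x + y) (A (x + y))"
    using assms by (auto intro: positive_nonneg)
  then show "ip (x + y) (A (x + y)) \<le> 2 * ip x (A x) + 2 * ip y (A y)"
    and "ip (x - y) (A (x - y)) \<le> 2 * ip x (A x) + 2 * ip y (A y)"
    by (simp_all add: positive_add[OF assms] positive_diff[OF assms] ip_simps s)
qed

text \<open>Positivity of \<open>A\<close> at \<open>v - K A v\<close> turns \<open>K A K \<le> K\<close> into \<open>A K A \<le> A\<close> without operator square roots.\<close>

lemma sandwich_swap:
  assumes A: "positive A" and K: "positive K" and le: "\<And>x. ip (K x) (A (K x)) \<le> ip x (K x)"
  shows "ip (A v) (K (A v)) \<le> ip v (A v)"
proof -
  let ?w = "K (A v)"
  have "0 \<le> ip (v - ?w) (A (v - ?w))" using A by (rule positive_nonneg)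
  also have "\<dots> = ip v (A v) - 2 * ip (A v) ?w + ip ?w (A ?w)"
    using positive_sym[OF A, of v ?w] by (simp add: positive_diff[OF A] ip_simps ip_sym[of ?w "A v"])
  finally show ?thesis using le[of "A v"] by simp
qed

text \<open>\<open>K\<close> is the inverse of I + S with S = T + R, where \<open>T\<close> is the
  correct effect and \<open>R\<close> the sum of its competitors. The proof rests on the vector z =
  2 K v - v, whose squared norm is exactly |v|^2 - 4 <K v, S K v>. Nonnegativity of that norm is the
  second claim, and the first one bounds it from above together with 4 <K v, R K v>.\<close>

lemma resolvent_measurement_bound:
  assumes T: "positive T" and T1: "\<And>x. ip x (T x) \<le> ip x x" and R: "positive R"
    and K: "positive K"
    and KS: "\<And>x. K x + (T (K x) + R (K x)) = x" and SK: "\<And>x. K x + K (T x + R x) = x"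
  shows "ip v v - 4 * ip (K v) (T (K v)) \<le> 6 * (ip v v - ip v (T v)) + 8 * ip v (R v)"
    and "4 * ip (K v) (T (K v) + R (K v)) \<le> ip v v"
proof -
  have S: "T (K x) + R (K x) = x - K x" for x using KS[of x] by (simp add: algebra_simps)
  have KSK: "ip (K x) (T (K x)) + ip (K x) (R (K x)) = ip x (K x) - ip (K x) (K x)" for x
    using arg_cong[OF S[of x], of "ip (K x)"] ip_sym[of "K x" x] by (simp add: ip_simps)
  have KK: "ip (K x) (K x) \<le> ip x (K x)" for x
    using KSK[of x] positive_nonneg[OF T, of "K x"] positive_nonneg[OF R, of "K x"] by simp
  have KRK: "ip (K x) (R (K x)) \<le> ip x (K x)" for x
    using KSK[of x] positive_nonneg[OF T, of "K x"] ip_nonneg[of "K x"] by simp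
  \<comment> \<open>The complement of \<open>T\<close> is swapped with \<open>K\<close> as well. The
    premise K T' K \<le> K of \<open>sandwich_swap\<close> holds because K T' K is at most K^2,
    which is at most K.\<close>
  let ?T' = "\<lambda>x. x - T x"
  have T': "positive ?T'"
    using T T1 by (auto simp: positive_def ip_simps)
  have KTK: "ip (K x) (?T' (K x)) \<le> ip x (K x)" for x
    using KK[of x] positive_nonneg[OF T, of "K x"] by (simp add: ip_simps)
  \<comment> \<open>Since v is (I + S) K v, the vector z equals K applied to y = (I - S) v, and y
    splits into the failure part (I - T) v and the interference part R v.\<close>
  define z where "z = K v + K v - v"
  define y where "y = (v - T v) - R v"
  have zy: "z = K y"
  proof -
    have "K y = K v - K (T v + R v)"
      using positive_diff[OF K, of v "T v + R v"] by (simp add: y_def algebra_simps)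
    also have "K (T v + R v) = v - K v" using SK[of v] by (simp add: algebra_simps)
    finally show ?thesis by (simp add: z_def)
  qed
  have zz: "ip z z = ip v v - 4 * (ip (K v) (T (K v)) + ip (K v) (R (K v)))"
    unfolding KSK z_def using ip_sym[of "K v" v] by (simp add: ip_simps)
  show "4 * ip (K v) (T (K v) + R (K v)) \<le> ip v v"
    using zz ip_nonneg[of z] by (simp add: ip_simps)
  \<comment> \<open>Because 2 K v = v + z, the interference seen after \<open>K\<close> is
    controlled by the interference at \<open>v\<close> and at \<open>z\<close>.\<close>
  have "ip (v + z) (R (v + z)) = 4 * ip (K v) (R (K v))"
    by (simp add: z_def positive_add[OF R] ip_simps)
  then have "4 * ip (K v) (R (K v)) \<le> 2 * ip v (R v) + 2 * ip z (R z)"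
    using positive_add_le(1)[OF R, of v z] by simp
  \<comment> \<open>The coefficient 3 is 1 from the squared norm of \<open>z\<close> plus 2 from <z,
    R z>. Splitting <y, K y> costs a further factor 2, which gives 3 * 2 = 6 for I - T and 2 + 3 * 2
    = 8 for R.\<close>
  then have "ip v v - 4 * ip (K v) (T (K v)) \<le> 2 * ip v (R v) + 3 * ip y (K y)"
    using zz KK[of y] KRK[of y] unfolding zy by simp
  moreover have "ip y (K y) \<le> 2 * ip (?T' v) (K (?T' v)) + 2 * ip (R v) (K (R v))"
    unfolding y_def by (rule positive_add_le(2)[OF K])
  moreover have "ip (R v) (K (R v)) \<le> ip v (R v)"
    by (rule sandwich_swap[OF R K KRK])
  moreover have "ip (?T' v) (K (?T' v)) \<le> ip v (?T' v)"
    by (rule sandwich_swap[OF T' K KTK])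
  ultimately show "ip v v - 4 * ip (K v) (T (K v)) \<le> 6 * (ip v v - ip v (T v)) + 8 * ip v (R v)"
    by (simp add: ip_simps)
qed

end

section \<open>Finite sums of matrices and matrices acting on functions\<close>

definition matsum :: "nat \<Rightarrow> 'i set \<Rightarrow> ('i \<Rightarrow> complex mat) \<Rightarrow> complex mat" where
  "matsum d I T = mat d d (\<lambda>(r,c). \<Sum>i\<in>I. T i $$ (r,c))"

lemma matsum_carrier [simp]: "matsum d I T \<in> carrier_mat d d"
  and matsum_index [simp]: "i < d \<Longrightarrow> j < d \<Longrightarrow> matsum d I T $$ (i,j) = (\<Sum>m\<in>I. T m $$ (i,j))"
  by (simp_all add: matsum_def)

lemma qform_matsum: "qform d (matsum d I T) f = (\<Sum>m\<in>I. qform d (T m) f)"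
proof -
  have "qform d (matsum d I T) f = (\<Sum>i<d. \<Sum>j<d. \<Sum>m\<in>I. cnj (f i) * T m $$ (i,j) * f j)"
    unfolding qform_def by (intro sum.cong refl) (simp add: sum_distrib_left sum_distrib_right)
  also have "\<dots> = (\<Sum>i<d. \<Sum>m\<in>I. \<Sum>j<d. cnj (f i) * T m $$ (i,j) * f j)"
    by (rule sum.cong[OF refl], rule sum.swap)
  also have "\<dots> = (\<Sum>m\<in>I. qform d (T m) f)"
    unfolding qform_def by (rule sum.swap)
  finally show ?thesis .
qed

lemma psd_matsum:
  assumes "\<And>m. m \<in> I \<Longrightarrow> psd d (T m)"
  shows "psd d (matsum d I T)"
proof -
  have "matsum d I T $$ (i,j) = cnj (matsum d I T $$ (j,i))" if ij: "i < d" "j < d" for i j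
  proof -
    have "T m $$ (i,j) = cnj (T m $$ (j,i))" if "m \<in> I" for m
      using assms[OF that] ij unfolding psd_def hermitian_iff by blast
    then have "(\<Sum>m\<in>I. T m $$ (i,j)) = (\<Sum>m\<in>I. cnj (T m $$ (j,i)))"
      by (rule sum.cong[OF refl])
    then show ?thesis using ij by simp
  qed
  then have "hermitian d (matsum d I T)"
    unfolding hermitian_iff using matsum_carrier by blast
  moreover have "0 \<le> Re (qform d (matsum d I T) f)" for f
    using assms by (auto simp: qform_matsum psdD intro!: sum_nonneg)
  ultimately show ?thesis by (simp add: psd_iff)
qed

definition matapp :: "nat \<Rightarrow> complex mat \<Rightarrow> (nat \<Rightarrow> complex) \<Rightarrow> nat \<Rightarrow> complex" where
  "matapp d A f = (\<lambda>i. \<Sum>j<d. A $$ (i,j) * f j)"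

lemma matapp_mult:
  assumes "A \<in> carrier_mat d d" "B \<in> carrier_mat d d" "i < d"
  shows "matapp d A (matapp d B f) i = matapp d (A * B) f i"
proof -
  have "matapp d A (matapp d B f) i = (\<Sum>j<d. \<Sum>l<d. A $$ (i,j) * B $$ (j,l) * f l)"
    by (simp add: matapp_def sum_distrib_left mult.assoc)
  also have "\<dots> = (\<Sum>l<d. \<Sum>j<d. A $$ (i,j) * B $$ (j,l) * f l)"
    by (rule sum.swap)
  also have "\<dots> = (\<Sum>l<d. (A * B) $$ (i,l) * f l)"
    using assms by (intro sum.cong refl) (simp add: index_mult_mat_sum[of A d d B d] sum_distrib_right del: index_mult_mat)
  finally show ?thesis by (simp add: matapp_def)
qed

lemma qform_matapp: "qform d A f = (\<Sum>i<d. cnj (f i) * matapp d A f i)"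
  by (simp add: qform_def matapp_def sum_distrib_left mult.assoc)

lemma matapp_adjoint:
  assumes "hermitian d A"
  shows "(\<Sum>i<d. cnj (matapp d A f i) * g i) = (\<Sum>i<d. cnj (f i) * matapp d A g i)"
proof -
  have h: "A $$ (i,j) = cnj (A $$ (j,i))" if "i < d" "j < d" for i j
    using assms that unfolding hermitian_iff by blast
  have "(\<Sum>i<d. cnj (matapp d A f i) * g i) = (\<Sum>i<d. \<Sum>j<d. cnj (f j) * (cnj (A $$ (i,j)) * g i))"
    by (simp add: matapp_def sum_distrib_right sum_distrib_left mult_ac)
  also have "\<dots> = (\<Sum>j<d. \<Sum>i<d. cnj (f j) * (cnj (A $$ (i,j)) * g i))"
    by (rule sum.swap)
  also have "\<dots> = (\<Sum>j<d. \<Sum>i<d. cnj (f j) * (A $$ (j,i) * g i))"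
    by (intro sum.cong refl) (metis h lessThan_iff)
  finally show ?thesis by (simp add: matapp_def sum_distrib_left)
qed

lemma qform_sandwich:
  assumes K: "hermitian d K" and T: "T \<in> carrier_mat d d"
  shows "qform d (K * T * K) f = qform d T (matapp d K f)"
proof -
  have Kc: "K \<in> carrier_mat d d" using K by (simp add: hermitian_def)
  have "qform d (K * T * K) f = (\<Sum>i<d. cnj (f i) * matapp d K (matapp d T (matapp d K f)) i)"
    unfolding qform_matapp
  proof (intro sum.cong refl)
    fix i assume "i \<in> {..<d}"
    then have i: "i < d" by simp
    have "matapp d K (matapp d T (matapp d K f)) i = matapp d (K * T) (matapp d K f) i"
      by (rule matapp_mult[OF Kc T i])
    also have "\<dots> = matapp d (K * T * K) f i"
      by (rule matapp_mult) (use Kc T i in auto)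
    finally show "cnj (f i) * matapp d (K * T * K) f i = cnj (f i) * matapp d K (matapp d T (matapp d K f)) i"
      by simp
  qed
  also have "\<dots> = (\<Sum>i<d. cnj (matapp d K f i) * matapp d T (matapp d K f) i)"
    by (rule matapp_adjoint[OF K, symmetric])
  finally show ?thesis by (simp add: qform_matapp)
qed

text \<open>Functional calculus: \<open>K\<close> has eigenvalues 1 / (1 + s) in an eigenbasis of
  \<open>S\<close>, with denominators positive because \<open>S\<close> is positive.\<close>

lemma psd_resolvent:
  assumes "psd d S"
  obtains K where "psd d K" "K + S * K = 1\<^sub>m d" "K + K * S = 1\<^sub>m d"
proof -
  obtain U s where U: "unitary d U" and S: "S = U * diag_real d s * adj U"
    using hermitian_spectral[of d S] assms by (auto simp: psd_def)
  have Uc: "U \<in> carrier_mat d d" and UU: "adj U * U = 1\<^sub>m d" "U * adj U = 1\<^sub>m d"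
    using U by (auto simp: unitary_def)
  have s: "0 \<le> s k" if "k < d" for k
    using psdD[OF assms] qform_conj_diag_column[OF U that, of s] S by (metis Re_complex_of_real)
  define r where "r k = 1 / (1 + s k)" for k
  define K where "K = U * diag_real d r * adj U"
  \<comment> \<open>Matrices diagonal in the same basis multiply through their eigenvalues.\<close>
  have mult: "(U * diag_real d a * adj U) * (U * diag_real d b * adj U) = U * diag_real d (\<lambda>k. a k * b k) * adj U" for a b
  proof -
    have D: "diag_real d a * diag_real d b = diag_real d (\<lambda>k. a k * b k)"
    proof (rule eq_matI)
      fix i j assume "i < dim_row (diag_real d (\<lambda>k. a k * b k))" "j < dim_col (diag_real d (\<lambda>k. a k * b k))"
      then have ij: "i < d" "j < d" by auto
      have "(diag_real d a * diag_real d b) $$ (i,j) = (\<Sum>k<d. diag_real d a $$ (i,k) * diag_real d b $$ (k,j))"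
        by (rule index_mult_mat_sum) (use ij in auto)
      also have "\<dots> = (\<Sum>k<d. if k = i then (if i = j then complex_of_real (a i * b i) else 0) else 0)"
        using ij by (intro sum.cong refl) auto
      finally show "(diag_real d a * diag_real d b) $$ (i,j) = diag_real d (\<lambda>k. a k * b k) $$ (i,j)"
        using ij by simp
    qed auto
    have "(U * diag_real d a * adj U) * (U * diag_real d b * adj U) =
        U * (diag_real d a * ((adj U * U) * (diag_real d b * adj U)))"
      using Uc by (simp add: assoc_mult_mat[of _ d d _ d _ d])
    also have "\<dots> = U * (diag_real d a * diag_real d b) * adj U"
      using Uc by (simp add: UU assoc_mult_mat[of _ d d _ d _ d])
    finally show ?thesis unfolding D .
  qed
  \<comment> \<open>Eigenvalue lists adding up to 1 give the identity; this is applied to r + s r =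
    1.\<close>
  have add: "U * diag_real d a * adj U + U * diag_real d b * adj U = 1\<^sub>m d"
    if ab: "\<And>k. k < d \<Longrightarrow> a k + b k = 1" for a b
  proof (rule eq_matI)
    fix i j assume "i < dim_row (1\<^sub>m d :: complex mat)" "j < dim_col (1\<^sub>m d :: complex mat)"
    then have ij: "i < d" "j < d" by auto
    have "(U * diag_real d a * adj U + U * diag_real d b * adj U) $$ (i,j) =
       (\<Sum>k<d. complex_of_real (a k) * U $$ (i,k) * cnj (U $$ (j,k))) +
       (\<Sum>k<d. complex_of_real (b k) * U $$ (i,k) * cnj (U $$ (j,k)))"
      using ij Uc by (simp add: conj_diag_index[OF Uc] del: index_mult_mat(1))
    also have "\<dots> = (\<Sum>k<d. U $$ (i,k) * adj U $$ (k,j))"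
    proof -
      have "complex_of_real (a k) * U $$ (i,k) * cnj (U $$ (j,k)) + complex_of_real (b k) * U $$ (i,k) * cnj (U $$ (j,k))
          = U $$ (i,k) * adj U $$ (k,j)" if k: "k < d" for k
      proof -
        have "complex_of_real (a k) + complex_of_real (b k) = 1"
          using ab[OF k] by (simp flip: of_real_add)
        then show ?thesis using Uc ij k by (simp flip: distrib_right)
      qed
      then show ?thesis by (simp flip: sum.distrib)
    qed
    also have "\<dots> = (U * adj U) $$ (i,j)"
      by (rule index_mult_mat_sum[symmetric]) (use Uc ij in auto)
    finally show "(U * diag_real d a * adj U + U * diag_real d b * adj U) $$ (i,j) = 1\<^sub>m d $$ (i,j)"
      by (simp add: UU)
  qed (use Uc in auto)
  have "psd d K" unfolding K_def by (rule psd_conj_diag[OF Uc]) (use s in \<open>auto simp: r_def\<close>)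
  moreover have "K + S * K = 1\<^sub>m d" "K + K * S = 1\<^sub>m d"
    unfolding K_def S mult using s by (auto intro!: add simp: r_def add_nonneg_eq_0_iff field_simps)
  ultimately show ?thesis by (rule that)
qed


lemma psd_smult:
  assumes "psd d A" "0 \<le> c"
  shows "psd d (complex_of_real c \<cdot>\<^sub>m A)"
    and "qform d (complex_of_real c \<cdot>\<^sub>m A) f = complex_of_real c * qform d A f"
proof -
  have A: "A \<in> carrier_mat d d" using assms(1) by (rule psd_carrier)
  have q: "qform d (complex_of_real c \<cdot>\<^sub>m A) f = complex_of_real c * qform d A f" for f
    using A by (simp add: qform_def sum_distrib_left mult_ac)
  have "(complex_of_real c \<cdot>\<^sub>m A) $$ (i,j) = cnj ((complex_of_real c \<cdot>\<^sub>m A) $$ (j,i))" if ij: "i < d" "j < d" for i j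
  proof -
    have "A $$ (i,j) = cnj (A $$ (j,i))"
      using assms(1) ij unfolding psd_def hermitian_iff by blast
    then show ?thesis using A ij by simp
  qed
  moreover have "complex_of_real c \<cdot>\<^sub>m A \<in> carrier_mat d d" using A by simp
  ultimately have "hermitian d (complex_of_real c \<cdot>\<^sub>m A)"
    unfolding hermitian_iff by blast
  then show "psd d (complex_of_real c \<cdot>\<^sub>m A)" using psdD[OF assms(1)] assms(2) by (simp add: psd_iff q)
  show "qform d (complex_of_real c \<cdot>\<^sub>m A) f = complex_of_real c * qform d A f" by (rule q)
qed

lemma psd_sandwich:
  assumes "psd d K" "psd d T"
  shows "psd d (K * T * K)"
proof -
  have K: "hermitian d K" "adj K = K" "K \<in> carrier_mat d d" and T: "hermitian d T" "T \<in> carrier_mat d d"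
    using assms by (auto simp: psd_def hermitian_def)
  have "hermitian d (K * T * K)" using hermitian_conj[OF T(1) K(3)] by (simp add: K(2))
  then show ?thesis using psdD[OF assms(2)] by (simp add: psd_iff qform_sandwich[OF K(1) T(2)])
qed

lemma matapp_add: "matapp d A (f + g) i = matapp d A f i + matapp d A g i"
  by (simp add: matapp_def sum.distrib distrib_left)

lemma matapp_cong: "(\<And>j. j < d \<Longrightarrow> f j = g j) \<Longrightarrow> matapp d A f i = matapp d A g i"
  by (simp add: matapp_def)

lemma matapp_add_mat:
  "A \<in> carrier_mat d d \<Longrightarrow> B \<in> carrier_mat d d \<Longrightarrow> i < d \<Longrightarrow>
    matapp d (A + B) f i = matapp d A f i + matapp d B f i"
  by (simp add: matapp_def sum.distrib distrib_right)

lemma matapp_one: "i < d \<Longrightarrow> matapp d (1\<^sub>m d) f i = f i"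
proof -
  assume i: "i < d"
  have "matapp d (1\<^sub>m d) f i = (\<Sum>j<d. if j = i then f i else 0)"
    unfolding matapp_def using i by (intro sum.cong refl) auto
  then show ?thesis using i by simp
qed

text \<open>Each \<open>E m\<close> is 4 K T K for the effect \<open>T m\<close>, with
  \<open>K\<close> the resolvent of the sum of all effects. The error estimate is stated for
  quadratic forms, so it holds for all output states at once, with a missed-detection term and a
  term for the competing effects.\<close>

lemma resolvent_measurement:
  assumes I: "finite I" and T: "\<And>m. m \<in> I \<Longrightarrow> effect d (T m)"
  obtains E where "\<And>m. m \<in> I \<Longrightarrow> psd d (E m)" "psd d (1\<^sub>m d - matsum d I E)"
    "\<And>m f. m \<in> I \<Longrightarrow> sqnorm d f - Re (qform d (E m) f) \<le>
      6 * (sqnorm d f - Re (qform d (T m) f)) + 8 * (\<Sum>m'\<in>I-{m}. Re (qform d (T m') f))"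
proof -
  define S where "S = matsum d I T"
  have Tp: "psd d (T m)" if "m \<in> I" for m using T[OF that] by (simp add: effect_def)
  have S: "psd d S" unfolding S_def by (rule psd_matsum) (rule Tp)
  have Sc: "S \<in> carrier_mat d d" by (simp add: S_def)
  obtain K where K: "psd d K" and SK: "K + S * K = 1\<^sub>m d" and KS: "K + K * S = 1\<^sub>m d"
    using psd_resolvent[OF S] by blast
  have Kh: "hermitian d K" and Kc: "K \<in> carrier_mat d d" using K by (auto simp: psd_def hermitian_def)
  define ip where "ip f g = Re (\<Sum>i<d. cnj (f i) * g i)" for f g :: "nat \<Rightarrow> complex"
  have ip_self: "ip f f = sqnorm d f" for f
    unfolding ip_def of_real_sqnorm[symmetric] by simp
  interpret semi_inner_product ip
  proof
    fix x y z :: "nat \<Rightarrow> complex"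
    show "ip (x + y) z = ip x z + ip y z" by (simp add: ip_def distrib_right sum.distrib)
    show "ip x y = ip y x" by (simp add: ip_def mult.commute)
    show "0 \<le> ip x x" by (simp add: ip_self)
  qed
  have ip_cong: "ip f g = ip f' g'" if "\<And>i. i < d \<Longrightarrow> f i = f' i" "\<And>i. i < d \<Longrightarrow> g i = g' i" for f g f' g'
    unfolding ip_def by (intro arg_cong[of _ _ Re] sum.cong refl) (simp add: that)
  \<comment> \<open>Setting the values beyond \<open>d\<close> to zero makes additivity and the
    splitting of \<open>S\<close> into effects hold as equations between functions.\<close>
  define op where "op A f = (\<lambda>i. if i < d then matapp d A f i else 0)" for A f
  \<comment> \<open>Continuing \<open>K\<close> by the identity beyond dimension \<open>d\<close> keeps it an exact inverse of \<open>I + S\<close>.\<close>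
  define Kop where "Kop f = (\<lambda>i. if i < d then matapp d K f i else f i)" for f
  have op_pos: "positive (op A)" if A: "psd d A" for A
  proof -
    have "ip (op A x) y = ip x (op A y)" for x y
    proof -
      have "ip (op A x) y = ip (matapp d A x) y" by (rule ip_cong) (auto simp: op_def)
      also have "\<dots> = ip x (matapp d A y)"
        unfolding ip_def using matapp_adjoint[of d A x y] A by (simp only: psd_def)
      also have "\<dots> = ip x (op A y)" by (rule ip_cong) (auto simp: op_def)
      finally show ?thesis .
    qed
    moreover have "0 \<le> ip x (op A x)" for x
    proof -
      have "ip x (op A x) = Re (qform d A x)"
        unfolding qform_matapp ip_def[symmetric] by (rule ip_cong) (auto simp: op_def)
      then show ?thesis using psdD[OF A] by simp
    qed
    moreover have "op A (x + y) = op A x + op A y" for x y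
      by (auto simp: op_def matapp_add)
    ultimately show ?thesis by (simp add: positive_def)
  qed
  \<comment> \<open>The form reads only coordinates below \<open>d\<close>, where \<open>Kop\<close>
    and \<open>op K\<close> agree, so positivity of \<open>Kop\<close> reduces to that of
    \<open>op K\<close>.\<close>
  have Kop: "ip (Kop x) y = ip (op K x) y" "ip y (Kop x) = ip y (op K x)" for x y
    by (auto intro!: ip_cong simp: Kop_def op_def)
  have Kop_pos: "positive Kop"
    using op_pos[OF K] by (auto simp: positive_def Kop) (auto simp: Kop_def matapp_add)
  have ip_op: "ip f (op A f) = Re (qform d A f)" for A f
    unfolding qform_matapp ip_def[symmetric] by (rule ip_cong) (auto simp: op_def)
  have qform_Kop: "qform d A (Kop f) = qform d A (matapp d K f)" for A f
    unfolding qform_def by (intro sum.cong refl) (simp add: Kop_def)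
  have KopS: "Kop x + op S (Kop x) = x" for x
  proof
    fix i
    show "(Kop x + op S (Kop x)) i = x i"
    proof (cases "i < d")
      case True
      have "matapp d S (Kop x) i = matapp d S (matapp d K x) i"
        by (rule matapp_cong) (simp add: Kop_def)
      also have "\<dots> = matapp d (S * K) x i" by (rule matapp_mult[OF Sc Kc True])
      finally have "(Kop x + op S (Kop x)) i = matapp d (K + S * K) x i"
        using True Sc Kc by (simp add: Kop_def op_def matapp_add_mat)
      then show ?thesis using True by (simp add: SK matapp_one)
    qed (simp add: Kop_def op_def)
  qed
  have SKop: "Kop x + Kop (op S x) = x" for x
  proof
    fix i
    show "(Kop x + Kop (op S x)) i = x i"
    proof (cases "i < d")
      case True
      have "matapp d K (op S x) i = matapp d K (matapp d S x) i"
        by (rule matapp_cong) (simp add: op_def)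
      also have "\<dots> = matapp d (K * S) x i" by (rule matapp_mult[OF Kc Sc True])
      finally have "(Kop x + Kop (op S x)) i = matapp d (K + K * S) x i"
        using True Sc Kc by (simp add: Kop_def matapp_add_mat)
      then show ?thesis using True by (simp add: KS matapp_one)
    qed (simp add: Kop_def op_def)
  qed
  define E where "E m = complex_of_real 4 \<cdot>\<^sub>m (K * T m * K)" for m
  have E: "psd d (E m)" if "m \<in> I" for m
    unfolding E_def by (intro psd_smult psd_sandwich K Tp[OF that]) simp
  have qE: "Re (qform d (E m) f) = 4 * ip (Kop f) (op (T m) (Kop f))" if m: "m \<in> I" for m f
  proof -
    have "qform d (E m) f = complex_of_real 4 * qform d (K * T m * K) f"
      unfolding E_def by (rule psd_smult(2)[OF psd_sandwich[OF K Tp[OF m]]]) simp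
    also have "qform d (K * T m * K) f = qform d (T m) (Kop f)"
      unfolding qform_sandwich[OF Kh psd_carrier[OF Tp[OF m]]] qform_Kop ..
    finally show ?thesis by (simp add: ip_op)
  qed
  show ?thesis
  proof (rule that[of E])
    show "psd d (E m)" if "m \<in> I" for m by (rule E[OF that])
    have h: "hermitian d (1\<^sub>m d - matsum d I E)"
      using psd_matsum[of I d E] E by (intro hermitian_minus) (auto simp: psd_def)
    have "0 \<le> Re (qform d (1\<^sub>m d - matsum d I E) f)" for f
    proof -
      have "Re (qform d (1\<^sub>m d - matsum d I E) f) = ip f f - (\<Sum>m\<in>I. Re (qform d (E m) f))"
        by (simp add: qform_minus qform_one qform_matsum ip_self)
      also have "(\<Sum>m\<in>I. Re (qform d (E m) f)) = 4 * Re (qform d S (Kop f))"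
        by (simp add: qE S_def qform_matsum sum_distrib_left ip_op)
      also have "\<dots> = 4 * ip (Kop f) (0 + op S (Kop f))"
        by (simp add: ip_op)
      finally have "Re (qform d (1\<^sub>m d - matsum d I E) f) = ip f f - 4 * ip (Kop f) (0 + op S (Kop f))" .
      \<comment> \<open>The elements \<open>E m\<close> add up to 4 K S K. The second abstract bound
        is taken with first operator 0 and second operator \<open>S\<close>, so that it speaks of
        the whole sum.\<close>
      moreover have "4 * ip (Kop f) (0 + op S (Kop f)) \<le> ip f f"
      proof (rule resolvent_measurement_bound(2)[where T = "\<lambda>_. 0" and R = "op S" and K = Kop])
        have z: "ip x 0 = 0" "ip 0 x = 0" for x by (simp_all add: ip_def)
        show "positive (\<lambda>_. 0)" by (simp add: positive_def z)
        show "ip x 0 \<le> ip x x" for x by (simp add: z ip_nonneg)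
      qed (use op_pos[OF S] Kop_pos KopS SKop in simp_all)
      ultimately show ?thesis by linarith
    qed
    then show "psd d (1\<^sub>m d - matsum d I E)" using h by (simp add: psd_iff)
  next
    fix m f assume m: "m \<in> I"
    \<comment> \<open>For a single message the sum of effects is split into its own effect and the
      competitors, collected in \<open>R\<close>.\<close>
    define R where "R = matsum d (I - {m}) T"
    have R: "psd d R" unfolding R_def by (rule psd_matsum) (use Tp in auto)
    have split: "op (T m) g + op R g = op S g" for g
    proof
      fix i
      show "(op (T m) g + op R g) i = op S g i"
        by (auto simp: op_def matapp_def R_def S_def sum.remove[OF I m] distrib_right sum.distrib)
    qed
    have "ip f f - 4 * ip (Kop f) (op (T m) (Kop f)) \<le> 6 * (ip f f - ip f (op (T m) f)) + 8 * ip f (op R f)"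
    proof (rule resolvent_measurement_bound(1))
      show "ip x (op (T m) x) \<le> ip x x" for x
        using T[OF m] by (simp add: ip_op ip_self effect_iff)
    qed (use op_pos[OF Tp[OF m]] op_pos[OF R] Kop_pos KopS SKop split in simp_all)
    then show "sqnorm d f - Re (qform d (E m) f) \<le>
      6 * (sqnorm d f - Re (qform d (T m) f)) + 8 * (\<Sum>m'\<in>I-{m}. Re (qform d (T m') f))"
      by (simp add: qE[OF m] ip_op ip_self R_def qform_matsum)
  qed
qed

section \<open>Choosing a codebook by averaging\<close>

lemma exists_le_average:
  fixes p F :: "nat \<Rightarrow> real"
  assumes "\<And>i. i < N \<Longrightarrow> 0 \<le> p i" "(\<Sum>i<N. p i) = 1"
  shows "\<exists>i<N. F i \<le> (\<Sum>i<N. p i * F i)"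
proof (rule ccontr)
  assume "\<not> ?thesis"
  then have gt: "(\<Sum>i<N. p i * F i) < F i" if "i < N" for i using that by force
  let ?a = "\<Sum>i<N. p i * F i"
  \<comment> \<open>Strictness of the averaged inequality comes from an index of nonzero weight,
    which exists because the weights sum to 1.\<close>
  obtain j where j: "j < N" "p j \<noteq> 0" using assms(2) by (metis sum.neutral lessThan_iff zero_neq_one)
  have "(\<Sum>i<N. p i * ?a) < (\<Sum>i<N. p i * F i)"
  proof (rule sum_strict_mono_ex1)
    show "\<forall>i\<in>{..<N}. p i * ?a \<le> p i * F i"
      using mult_left_mono[OF less_imp_le[OF gt] assms(1)] by auto
    show "\<exists>i\<in>{..<N}. p i * ?a < p i * F i"
      using j assms(1)[OF j(1)] gt[OF j(1)] by (intro bexI[of _ j]) auto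
  qed simp
  moreover have "(\<Sum>i<N. p i * ?a) = ?a" unfolding sum_distrib_right[symmetric] assms(2) by simp
  ultimately show False by simp
qed

text \<open>Derandomisation of an i.i.d. choice of codewords: the codewords are fixed one after the other,
  and the pair interactions with a fixed codeword are absorbed into the single-letter cost \<open>g\<close>.\<close>

lemma exists_codebook:
  fixes p g :: "nat \<Rightarrow> real" and h :: "nat \<Rightarrow> nat \<Rightarrow> real"
  assumes p: "\<And>i. i < N \<Longrightarrow> 0 \<le> p i" "(\<Sum>i<N. p i) = 1" and "finite I"
  shows "\<exists>x. (\<forall>m. x m < N) \<and> (\<Sum>m\<in>I. g (x m) + (\<Sum>m'\<in>I-{m}. h (x m) (x m'))) \<le>
     card I * (\<Sum>i<N. p i * g i) + card I * (real (card I) - 1) * (\<Sum>i<N. \<Sum>j<N. p i * p j * h i j)"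
  using \<open>finite I\<close>
proof (induction I arbitrary: g rule: finite_induct)
  case empty
  have "N \<noteq> 0" using p(2) by (cases N) auto
  then show ?case by (intro exI[of _ "\<lambda>_. 0"]) auto
next
  case (insert a I)
  define hb where "hb = (\<Sum>i<N. \<Sum>j<N. p i * p j * h i j)"
  define c where "c = real (card I)"
  \<comment> \<open>Once position \<open>a\<close> holds codeword \<open>i\<close>, its interactions
    with another codeword \<open>y\<close>, in both orders, become part of the cost of
    \<open>y\<close> alone.\<close>
  define G where "G i = (\<lambda>y. g y + h y i + h i y)" for i
  \<comment> \<open>\<open>F i\<close> is the bound that the induction hypothesis gives for the
    total cost when the new codeword is \<open>i\<close>.\<close>
  define F where "F i = g i + (c * (\<Sum>y<N. p y * G i y) + c * (c - 1) * hb)" for i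
  obtain i where i: "i < N" "F i \<le> (\<Sum>i<N. p i * F i)"
    using exists_le_average[OF p] by blast
  obtain x where x: "\<forall>m. x m < N" and xle: "(\<Sum>m\<in>I. G i (x m) + (\<Sum>m'\<in>I-{m}. h (x m) (x m'))) \<le>
      c * (\<Sum>y<N. p y * G i y) + c * (c - 1) * hb"
    using insert.IH[of "G i"] unfolding hb_def c_def by blast
  define x' where "x' = x(a := i)"
  have x'I: "x' m = x m" if "m \<in> I" for m using that insert.hyps by (auto simp: x'_def)
  have x'a: "x' a = i" by (simp add: x'_def)
  \<comment> \<open>The two orders of interaction have the same average \<open>hb\<close>, which
    produces the factor 2.\<close>
  have avg: "(\<Sum>i<N. p i * (\<Sum>y<N. p y * G i y)) = (\<Sum>i<N. p i * g i) + 2 * hb"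
  proof -
    have "(\<Sum>i<N. p i * (\<Sum>y<N. p y * G i y)) =
        (\<Sum>i<N. \<Sum>y<N. p i * (p y * g y)) + (\<Sum>i<N. \<Sum>y<N. p y * p i * h y i) + (\<Sum>i<N. \<Sum>y<N. p i * p y * h i y)"
      by (simp add: G_def sum_distrib_left sum.distrib algebra_simps)
    also have "(\<Sum>i<N. \<Sum>y<N. p i * (p y * g y)) = (\<Sum>i<N. p i) * (\<Sum>y<N. p y * g y)"
      by (rule sum_product[symmetric])
    also have "(\<Sum>i<N. \<Sum>y<N. p y * p i * h y i) = hb"
      unfolding hb_def by (rule sum.swap)
    finally show ?thesis using p(2) by (simp add: hb_def)
  qed
  have "(\<Sum>m\<in>insert a I. g (x' m) + (\<Sum>m'\<in>insert a I-{m}. h (x' m) (x' m'))) =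
      g i + (\<Sum>m'\<in>I. h i (x m')) + (\<Sum>m\<in>I. g (x' m) + (\<Sum>m'\<in>insert a I-{m}. h (x' m) (x' m')))"
    using insert.hyps by (simp add: x'a x'I)
  also have "(\<Sum>m\<in>I. g (x' m) + (\<Sum>m'\<in>insert a I-{m}. h (x' m) (x' m'))) =
      (\<Sum>m\<in>I. g (x m) + h (x m) i + (\<Sum>m'\<in>I-{m}. h (x m) (x m')))"
  proof (intro sum.cong refl)
    fix m assume m: "m \<in> I"
    then have "insert a I - {m} = insert a (I - {m})" using insert.hyps by auto
    then have "(\<Sum>m'\<in>insert a I-{m}. h (x' m) (x' m')) = h (x m) i + (\<Sum>m'\<in>I-{m}. h (x' m) (x' m'))"
      using insert.hyps m by (simp add: x'a x'I)
    also have "(\<Sum>m'\<in>I-{m}. h (x' m) (x' m')) = (\<Sum>m'\<in>I-{m}. h (x m) (x m'))"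
      using m by (intro sum.cong refl) (simp add: x'I)
    finally show "g (x' m) + (\<Sum>m'\<in>insert a I-{m}. h (x' m) (x' m')) =
        g (x m) + h (x m) i + (\<Sum>m'\<in>I-{m}. h (x m) (x m'))"
      using m by (simp add: x'I)
  qed
  also have "g i + (\<Sum>m'\<in>I. h i (x m')) + \<dots> = g i + (\<Sum>m\<in>I. G i (x m) + (\<Sum>m'\<in>I-{m}. h (x m) (x m')))"
    by (simp add: G_def sum.distrib)
  also have "\<dots> \<le> F i" using xle by (simp add: F_def)
  also have "\<dots> \<le> (\<Sum>i<N. p i * F i)" by (rule i(2))
  also have "\<dots> = (\<Sum>i<N. p i * g i) + c * (\<Sum>i<N. p i * (\<Sum>y<N. p y * G i y)) + (\<Sum>i<N. p i) * (c * (c - 1) * hb)"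
    by (simp add: F_def distrib_left sum.distrib sum_distrib_left sum_distrib_right mult.left_commute)
  \<comment> \<open>The pair count closes the induction: 2 c + c (c - 1) = (c + 1) c.\<close>
  also have "\<dots> = (c + 1) * (\<Sum>i<N. p i * g i) + (c + 1) * c * hb"
    unfolding avg p(2) by (simp add: algebra_simps)
  finally have "(\<Sum>m\<in>insert a I. g (x' m) + (\<Sum>m'\<in>insert a I-{m}. h (x' m) (x' m'))) \<le>
      (c + 1) * (\<Sum>i<N. p i * g i) + (c + 1) * c * hb" .
  moreover have "real (card (insert a I)) = c + 1" using insert.hyps by (simp add: c_def)
  ultimately show ?case using x i(1) by (intro exI[of _ x']) (auto simp: x'_def hb_def)
qed

section \<open>Separable inputs\<close>

lemma mult_add_less:
  fixes a k dA d :: nat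
  assumes "a < dA" "k < d"
  shows "a * d + k < dA * d"
proof -
  have "a * d + k < Suc a * d" using assms by simp
  also have "\<dots> \<le> dA * d" using assms by (intro mult_right_mono) auto
  finally show ?thesis .
qed

lemma div_mod_less:
  fixes i dA d :: nat
  assumes "i < dA * d"
  shows "i div d < dA" "i mod d < d" "i = (i div d) * d + i mod d"
proof -
  have "0 < d" using assms by (cases d) auto
  then show "i mod d < d" by simp
  show "i div d < dA" using assms by (simp add: less_mult_imp_div_less)
  show "i = (i div d) * d + i mod d" by simp
qed

lemma sum_lessThan_mult:
  fixes f :: "nat \<Rightarrow> 'a::comm_monoid_add"
  shows "(\<Sum>i<dA * d. f i) = (\<Sum>a<dA. \<Sum>k<d. f (a * d + k))"
proof -
  have "(\<Sum>i<dA * d. f i) = (\<Sum>a<dA. sum f {a * d..<a * d + d})"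
    by (rule sum.nat_group[symmetric])
  also have "\<dots> = (\<Sum>a<dA. \<Sum>k<d. f (a * d + k))"
    by (rule sum.cong[OF refl]) (simp add: sum.atLeastLessThan_shift_0[of f "_ * d"] lessThan_atLeast0)
  finally show ?thesis .
qed

lemma hermitian_ptrace1:
  assumes "hermitian (dX * dY) R"
  shows "hermitian dY (ptrace1 dX dY R)"
  unfolding hermitian_iff
proof (intro conjI allI impI)
  fix k l assume kl: "k < dY" "l < dY"
  have "R $$ (a * dY + k, a * dY + l) = cnj (R $$ (a * dY + l, a * dY + k))" if "a < dX" for a
    using assms mult_add_less[OF that kl(1)] mult_add_less[OF that kl(2)] unfolding hermitian_iff by blast
  then have "(\<Sum>a<dX. R $$ (a * dY + k, a * dY + l)) = (\<Sum>a<dX. cnj (R $$ (a * dY + l, a * dY + k)))"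
    by (intro sum.cong refl) simp
  then show "ptrace1 dX dY R $$ (k,l) = cnj (ptrace1 dX dY R $$ (l,k))"
    using kl by (simp add: ptrace1_def)
qed (simp add: ptrace1_def)

lemma hermitian_ptrace2:
  assumes "hermitian (dX * dY) R"
  shows "hermitian dX (ptrace2 dX dY R)"
  unfolding hermitian_iff
proof (intro conjI allI impI)
  fix a b assume ab: "a < dX" "b < dX"
  have "R $$ (a * dY + k, b * dY + k) = cnj (R $$ (b * dY + k, a * dY + k))" if "k < dY" for k
    using assms mult_add_less[OF ab(1) that] mult_add_less[OF ab(2) that] unfolding hermitian_iff by blast
  then have "(\<Sum>k<dY. R $$ (a * dY + k, b * dY + k)) = (\<Sum>k<dY. cnj (R $$ (b * dY + k, a * dY + k)))"
    by (intro sum.cong refl) simp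
  then show "ptrace2 dX dY R $$ (a,b) = cnj (ptrace2 dX dY R $$ (b,a))"
    using ab by (simp add: ptrace2_def)
qed (simp add: ptrace2_def)

lemma kron_carrier:
  "A \<in> carrier_mat m m \<Longrightarrow> B \<in> carrier_mat n n \<Longrightarrow> kron A B \<in> carrier_mat (m * n) (m * n)"
  by (auto simp: kron_def)

lemma kron_index:
  assumes "A \<in> carrier_mat m m" "B \<in> carrier_mat n n" "a < m" "b < m" "k < n" "l < n"
  shows "kron A B $$ (a * n + k, b * n + l) = A $$ (a,b) * B $$ (k,l)"
  using assms mult_add_less[of a m k n] mult_add_less[of b m l n] by (simp add: kron_def)

lemma hermitian_kron:
  assumes "hermitian m A" "hermitian n B"
  shows "hermitian (m * n) (kron A B)"
  unfolding hermitian_iff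
proof (intro conjI allI impI)
  have c: "A \<in> carrier_mat m m" "B \<in> carrier_mat n n" using assms by (auto simp: hermitian_def)
  then show "kron A B \<in> carrier_mat (m * n) (m * n)" by (rule kron_carrier)
  fix i j assume "i < m * n" "j < m * n"
  note i = div_mod_less[OF this(1)] and j = div_mod_less[OF this(2)]
  have "A $$ (i div n, j div n) = cnj (A $$ (j div n, i div n))" "B $$ (i mod n, j mod n) = cnj (B $$ (j mod n, i mod n))"
    using assms i j unfolding hermitian_iff by blast+
  then have "A $$ (i div n, j div n) * B $$ (i mod n, j mod n) = cnj (A $$ (j div n, i div n) * B $$ (j mod n, i mod n))"
    by (metis complex_cnj_mult)
  then show "kron A B $$ (i,j) = cnj (kron A B $$ (j,i))"
    using c \<open>i < m * n\<close> \<open>j < m * n\<close> by (simp add: kron_def)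
qed

section \<open>Channels on linear combinations and on states\<close>

lemma linear_map_zero:
  assumes "Defs.linear_map dK dH \<Phi>"
  shows "\<Phi> (0\<^sub>m dK dK) = 0\<^sub>m dH dH"
proof -
  let ?Z = "0\<^sub>m dK dK :: complex mat"
  have c: "\<Phi> ?Z \<in> carrier_mat dH dH" using assms by (simp add: Defs.linear_map_def)
  have "\<Phi> (0 \<cdot>\<^sub>m ?Z + 0 \<cdot>\<^sub>m ?Z) = 0 \<cdot>\<^sub>m \<Phi> ?Z + 0 \<cdot>\<^sub>m \<Phi> ?Z"
    using assms zero_carrier_mat[of dK dK] unfolding Defs.linear_map_def by blast
  moreover have "0 \<cdot>\<^sub>m ?Z + 0 \<cdot>\<^sub>m ?Z = ?Z" by (intro eq_matI) auto
  moreover have "0 \<cdot>\<^sub>m \<Phi> ?Z + 0 \<cdot>\<^sub>m \<Phi> ?Z = 0\<^sub>m dH dH" using c by (intro eq_matI) auto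
  ultimately show ?thesis by simp
qed

lemma linear_map_sum:
  fixes N :: nat
  assumes lin: "Defs.linear_map dK dH \<Phi>" and X: "\<And>i. i < N \<Longrightarrow> X i \<in> carrier_mat dK dK"
  shows "\<Phi> (mat dK dK (\<lambda>(k,l). \<Sum>i<N. c i * X i $$ (k,l))) = mat dH dH (\<lambda>(k,l). \<Sum>i<N. c i * \<Phi> (X i) $$ (k,l))"
  using X
proof (induction N)
  case 0
  have "mat dK dK (\<lambda>(k,l). \<Sum>i<0. c i * X i $$ (k,l)) = 0\<^sub>m dK dK" by (intro eq_matI) auto
  moreover have "mat dH dH (\<lambda>(k,l). \<Sum>i<0. c i * \<Phi> (X i) $$ (k,l)) = 0\<^sub>m dH dH" by (intro eq_matI) auto
  ultimately show ?case by (simp only: linear_map_zero[OF lin])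
next
  case (Suc N)
  let ?Y = "mat dK dK (\<lambda>(k,l). \<Sum>i<N. c i * X i $$ (k,l))"
  have XN: "X N \<in> carrier_mat dK dK" using Suc.prems by simp
  have c: "\<Phi> (X N) \<in> carrier_mat dH dH" using lin XN by (simp add: Defs.linear_map_def)
  have "mat dK dK (\<lambda>(k,l). \<Sum>i<Suc N. c i * X i $$ (k,l)) = 1 \<cdot>\<^sub>m ?Y + c N \<cdot>\<^sub>m X N"
    using XN by (intro eq_matI) auto
  also have "\<Phi> \<dots> = 1 \<cdot>\<^sub>m \<Phi> ?Y + c N \<cdot>\<^sub>m \<Phi> (X N)"
    using lin XN mat_carrier[of dK dK] unfolding Defs.linear_map_def by blast
  also have "\<Phi> ?Y = mat dH dH (\<lambda>(k,l). \<Sum>i<N. c i * \<Phi> (X i) $$ (k,l))"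
    by (rule Suc.IH) (use Suc.prems in simp)
  also have "1 \<cdot>\<^sub>m \<dots> + c N \<cdot>\<^sub>m \<Phi> (X N) = mat dH dH (\<lambda>(k,l). \<Sum>i<Suc N. c i * \<Phi> (X i) $$ (k,l))"
    using c by (intro eq_matI) auto
  finally show ?case .
qed

text \<open>Positivity is complete positivity with a one-dimensional ancilla, for which
  \<open>id_tensor\<close> is the channel itself.\<close>

lemma cptp_density:
  assumes "cptp dK dH \<Phi>" "density dK \<tau>"
  shows "density dH (\<Phi> \<tau>)"
proof -
  have \<tau>: "\<tau> \<in> carrier_mat dK dK" using assms(2) by (simp add: density_def psd_carrier)
  have \<Phi>\<tau>: "\<Phi> \<tau> \<in> carrier_mat dH dH" using assms(1) \<tau> by (simp add: cptp_def Defs.linear_map_def)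
  have "block dK \<tau> 0 0 = \<tau>" using \<tau> by (intro eq_matI) (auto simp: block_def)
  then have "id_tensor 1 dK dH \<Phi> \<tau> = \<Phi> \<tau>" using \<Phi>\<tau> by (intro eq_matI) (auto simp: id_tensor_def)
  moreover have "psd (1 * dH) (id_tensor 1 dK dH \<Phi> \<tau>)"
    using assms unfolding cptp_def density_def by (metis mult_1)
  ultimately have "psd dH (\<Phi> \<tau>)" by simp
  moreover have "mtrace (\<Phi> \<tau>) = 1" using assms \<tau> by (simp add: cptp_def density_def)
  ultimately show ?thesis by (simp add: density_def)
qed

text \<open>\<open>reduce dA d \<sigma> P\<close> is the partial trace \<open>Tr\<^sub>A[(\<sigma> \<otimes> I) P]\<close>.\<close>

definition reduce :: "nat \<Rightarrow> nat \<Rightarrow> complex mat \<Rightarrow> complex mat \<Rightarrow> complex mat" where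
  "reduce dA d \<sigma> P = mat d d (\<lambda>(k,l). \<Sum>a<dA. \<Sum>b<dA. \<sigma> $$ (b,a) * P $$ (a * d + k, b * d + l))"

lemma reduce_carrier [simp]: "reduce dA d \<sigma> P \<in> carrier_mat d d"
  by (simp add: reduce_def)

lemma qform_product:
  "qform (dA * d) P (\<lambda>i. u (i div d) * f (i mod d)) =
    (\<Sum>a<dA. \<Sum>k<d. \<Sum>b<dA. \<Sum>l<d. cnj (u a * f k) * P $$ (a * d + k, b * d + l) * (u b * f l))"
  unfolding qform_def sum_lessThan_mult by (intro sum.cong refl) simp

lemma sqnorm_product: "sqnorm (dA * d) (\<lambda>i. u (i div d) * f (i mod d)) = sqnorm dA u * sqnorm d f"
  unfolding sqnorm_def sum_lessThan_mult sum_product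
  by (intro sum.cong refl) (simp add: norm_mult power_mult_distrib)

text \<open>Writing \<sigma> as a sum of rank-one matrices turns the form of the reduced operator at
  \<open>f\<close> into forms of \<open>P\<close> at the product vectors of \<open>u m\<close> and
  \<open>f\<close>, so bounds on \<open>P\<close> carry over to \<open>reduce\<close>.\<close>

lemma qform_reduce_gram:
  fixes n :: nat
  assumes "\<And>a b. a < dA \<Longrightarrow> b < dA \<Longrightarrow> \<sigma> $$ (a,b) = (\<Sum>m<n. u m a * cnj (u m b))"
  shows "qform d (reduce dA d \<sigma> P) f = (\<Sum>m<n. qform (dA * d) P (\<lambda>i. u m (i div d) * f (i mod d)))"
proof -
  let ?t = "\<lambda>m a k b l. cnj (u m a * f k) * P $$ (a * d + k, b * d + l) * (u m b * f l)"
  have "qform d (reduce dA d \<sigma> P) f = (\<Sum>k<d. \<Sum>l<d. \<Sum>a<dA. \<Sum>b<dA. \<Sum>m<n. ?t m a k b l)"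
    unfolding qform_def reduce_def
    by (intro sum.cong refl) (simp add: assms sum_distrib_left sum_distrib_right mult_ac)
  \<comment> \<open>The exchanges bring \<open>m\<close> to the front and then restore the index
    order of \<open>qform_product\<close>.\<close>
  also have "\<dots> = (\<Sum>k<d. \<Sum>l<d. \<Sum>m<n. \<Sum>a<dA. \<Sum>b<dA. ?t m a k b l)"
    by (intro sum.cong[OF refl] sum_swap3)
  also have "\<dots> = (\<Sum>m<n. \<Sum>k<d. \<Sum>l<d. \<Sum>a<dA. \<Sum>b<dA. ?t m a k b l)"
    by (rule sum_swap3)
  also have "\<dots> = (\<Sum>m<n. \<Sum>k<d. \<Sum>a<dA. \<Sum>l<d. \<Sum>b<dA. ?t m a k b l)"
    by (intro sum.cong[OF refl] sum.swap)
  also have "\<dots> = (\<Sum>m<n. \<Sum>a<dA. \<Sum>k<d. \<Sum>l<d. \<Sum>b<dA. ?t m a k b l)"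
    by (intro sum.cong[OF refl] sum.swap)
  also have "\<dots> = (\<Sum>m<n. \<Sum>a<dA. \<Sum>k<d. \<Sum>b<dA. \<Sum>l<d. ?t m a k b l)"
    by (intro sum.cong[OF refl] sum.swap)
  finally show ?thesis by (simp only: qform_product)
qed

lemma hermitian_reduce:
  assumes "hermitian dA \<sigma>" "hermitian (dA * d) P"
  shows "hermitian d (reduce dA d \<sigma> P)"
  unfolding hermitian_iff
proof (intro conjI allI impI)
  fix k l assume kl: "k < d" "l < d"
  have "(\<Sum>a<dA. \<Sum>b<dA. \<sigma> $$ (b,a) * P $$ (a * d + k, b * d + l)) =
      (\<Sum>a<dA. \<Sum>b<dA. cnj (\<sigma> $$ (a,b)) * cnj (P $$ (b * d + l, a * d + k)))"
  proof (intro sum.cong refl)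
    fix a b assume "a \<in> {..<dA}" "b \<in> {..<dA}"
    then have "\<sigma> $$ (b,a) = cnj (\<sigma> $$ (a,b))" "P $$ (a * d + k, b * d + l) = cnj (P $$ (b * d + l, a * d + k))"
      using assms kl mult_add_less[of a dA k d] mult_add_less[of b dA l d] unfolding hermitian_iff by blast+
    then show "\<sigma> $$ (b,a) * P $$ (a * d + k, b * d + l) = cnj (\<sigma> $$ (a,b)) * cnj (P $$ (b * d + l, a * d + k))"
      by metis
  qed
  also have "\<dots> = (\<Sum>b<dA. \<Sum>a<dA. cnj (\<sigma> $$ (a,b)) * cnj (P $$ (b * d + l, a * d + k)))"
    by (rule sum.swap)
  finally show "reduce dA d \<sigma> P $$ (k,l) = cnj (reduce dA d \<sigma> P $$ (l,k))"
    using kl by (simp add: reduce_def)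
qed simp

text \<open>The form of \<open>P\<close> at a product vector lies between 0 and the product of the
  squared norms, and the squared norms of the vectors decomposing \<sigma> add up to its trace,
  which is 1.\<close>

lemma effect_reduce:
  assumes \<sigma>: "density dA \<sigma>" and P: "effect (dA * d) P"
  shows "effect d (reduce dA d \<sigma> P)"
proof -
  have s: "psd dA \<sigma>" "mtrace \<sigma> = 1" using \<sigma> by (auto simp: density_def)
  have sc: "\<sigma> \<in> carrier_mat dA dA" using s(1) by (rule psd_carrier)
  obtain u where u: "\<And>a b. a < dA \<Longrightarrow> b < dA \<Longrightarrow> \<sigma> $$ (a,b) = (\<Sum>m<dA. u m a * cnj (u m b))"
    using psd_gram[OF s(1)] by blast
  have "complex_of_real (\<Sum>m<dA. sqnorm dA (u m)) = (\<Sum>m<dA. \<Sum>a<dA. u m a * cnj (u m a))"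
    by (simp add: of_real_sqnorm mult.commute)
  also have "\<dots> = (\<Sum>a<dA. \<sigma> $$ (a,a))"
    by (subst sum.swap) (simp add: u)
  also have "\<dots> = 1" using s(2) sc by (simp add: mtrace_def)
  finally have tr: "(\<Sum>m<dA. sqnorm dA (u m)) = 1" unfolding of_real_eq_1_iff .
  have q: "qform d (reduce dA d \<sigma> P) f = (\<Sum>m<dA. qform (dA * d) P (\<lambda>i. u m (i div d) * f (i mod d)))" for f
    by (rule qform_reduce_gram) (rule u)
  have "Re (qform d (reduce dA d \<sigma> P) f) \<le> (\<Sum>m<dA. sqnorm dA (u m) * sqnorm d f)" for f
    unfolding q Re_sum using P by (intro sum_mono) (simp add: effect_iff flip: sqnorm_product)
  then have "Re (qform d (reduce dA d \<sigma> P) f) \<le> sqnorm d f" for f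
    using tr by (simp flip: sum_distrib_right)
  moreover have "0 \<le> Re (qform d (reduce dA d \<sigma> P) f)" for f
    unfolding q Re_sum using P by (intro sum_nonneg) (simp add: effect_iff)
  moreover have "hermitian d (reduce dA d \<sigma> P)"
    using s(1) P by (intro hermitian_reduce) (auto simp: psd_def effect_iff)
  ultimately show ?thesis by (simp add: effect_iff)
qed

text \<open>Linear extension of the identity Tr[P (\<sigma> \<otimes> V)] =
  Tr[Tr_A[(\<sigma> \<otimes> I) P] V]. It serves both the joint output state and the product of its
  marginals.\<close>

lemma mtrace_mult_product_sum:
  fixes N :: nat
  assumes c: "P \<in> carrier_mat (dA * d) (dA * d)" "Y \<in> carrier_mat (dA * d) (dA * d)"
    and V: "\<And>i. i < N \<Longrightarrow> V i \<in> carrier_mat d d"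
    and Y: "\<And>a b k l. a < dA \<Longrightarrow> b < dA \<Longrightarrow> k < d \<Longrightarrow> l < d \<Longrightarrow>
      Y $$ (a * d + k, b * d + l) = (\<Sum>i<N. w i * \<sigma> i $$ (a,b) * V i $$ (k,l))"
  shows "mtrace (P * Y) = (\<Sum>i<N. w i * mtrace (reduce dA d (\<sigma> i) P * V i))"
proof -
  let ?t = "\<lambda>i a k b l. w i * (\<sigma> i $$ (b,a) * P $$ (a * d + k, b * d + l)) * V i $$ (l,k)"
  have "mtrace (P * Y) = (\<Sum>a<dA. \<Sum>k<d. \<Sum>b<dA. \<Sum>l<d. \<Sum>i<N. ?t i a k b l)"
    unfolding mtrace_mult[OF c] sum_lessThan_mult
    by (intro sum.cong refl) (simp add: Y sum_distrib_left mult_ac)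
  also have "\<dots> = (\<Sum>a<dA. \<Sum>k<d. \<Sum>i<N. \<Sum>b<dA. \<Sum>l<d. ?t i a k b l)"
    by (intro sum.cong[OF refl] sum_swap3)
  also have "\<dots> = (\<Sum>i<N. \<Sum>a<dA. \<Sum>k<d. \<Sum>b<dA. \<Sum>l<d. ?t i a k b l)"
    by (rule sum_swap3)
  also have "\<dots> = (\<Sum>i<N. \<Sum>k<d. \<Sum>a<dA. \<Sum>b<dA. \<Sum>l<d. ?t i a k b l)"
    by (intro sum.cong[OF refl] sum.swap)
  also have "\<dots> = (\<Sum>i<N. \<Sum>k<d. \<Sum>l<d. \<Sum>a<dA. \<Sum>b<dA. ?t i a k b l)"
    by (intro sum.cong[OF refl] sum_swap3)
  also have "\<dots> = (\<Sum>i<N. w i * mtrace (reduce dA d (\<sigma> i) P * V i))"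
  proof (intro sum.cong refl)
    fix i assume "i \<in> {..<N}"
    then have "V i \<in> carrier_mat d d" using V by simp
    then show "(\<Sum>k<d. \<Sum>l<d. \<Sum>a<dA. \<Sum>b<dA. ?t i a k b l) = w i * mtrace (reduce dA d (\<sigma> i) P * V i)"
      unfolding mtrace_mult[OF reduce_carrier \<open>V i \<in> carrier_mat d d\<close>]
      by (simp add: reduce_def sum_distrib_left sum_distrib_right mult_ac)
  qed
  finally show ?thesis .
qed


lemma mtrace_mult_lincomb:
  fixes N :: nat
  assumes T: "T \<in> carrier_mat d d" and Y: "Y \<in> carrier_mat d d"
    and V: "\<And>j. j < N \<Longrightarrow> V j \<in> carrier_mat d d"
    and Ye: "\<And>k l. k < d \<Longrightarrow> l < d \<Longrightarrow> Y $$ (k,l) = (\<Sum>j<N. w j * V j $$ (k,l))"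
  shows "mtrace (T * Y) = (\<Sum>j<N. w j * mtrace (T * V j))"
proof -
  have "mtrace (T * Y) = (\<Sum>k<d. \<Sum>l<d. \<Sum>j<N. w j * (T $$ (k,l) * V j $$ (l,k)))"
    unfolding mtrace_mult[OF T Y]
    by (intro sum.cong refl) (simp add: Ye sum_distrib_left mult_ac)
  also have "\<dots> = (\<Sum>j<N. \<Sum>k<d. \<Sum>l<d. w j * (T $$ (k,l) * V j $$ (l,k)))"
    by (rule sum_swap3)
  also have "\<dots> = (\<Sum>j<N. w j * mtrace (T * V j))"
    by (intro sum.cong refl) (simp add: mtrace_mult[OF T V] sum_distrib_left)
  finally show ?thesis .
qed

section \<open>Spectral quantities of one separable input\<close>

locale separable_input =
  fixes dA dK dH N :: nat and \<Phi> :: "complex mat \<Rightarrow> complex mat" and p :: "nat \<Rightarrow> real"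
    and \<sigma> \<tau> :: "nat \<Rightarrow> complex mat" and \<rho> :: "complex mat"
  assumes \<Phi>: "cptp dK dH \<Phi>"
    and p_nonneg: "\<And>i. i < N \<Longrightarrow> 0 \<le> p i" and p_sum: "(\<Sum>i<N. p i) = 1"
    and \<sigma>: "\<And>i. i < N \<Longrightarrow> density dA (\<sigma> i)" and \<tau>: "\<And>i. i < N \<Longrightarrow> density dK (\<tau> i)"
    and \<rho>: "\<rho> = mat (dA*dK) (dA*dK) (\<lambda>(r,c). \<Sum>i<N. complex_of_real (p i) * kron (\<sigma> i) (\<tau> i) $$ (r,c))"
    and psd_\<rho>: "psd (dA*dK) \<rho>"
begin

definition out :: "complex mat" where
  "out = id_tensor dA dK dH \<Phi> \<rho>"

definition marg :: "complex mat" where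
  "marg = kron (ptrace2 dA dH out) (ptrace1 dA dH out)"

text \<open>At c = e^(n \<gamma>) this is the operator \<Pi>_n(\<gamma>) of the inf-spectral
  rate.\<close>

definition gap :: "real \<Rightarrow> complex mat" where
  "gap c = out - complex_of_real c \<cdot>\<^sub>m marg"

definition score :: "real \<Rightarrow> real" where
  "score c = Re (mtrace (nonneg_proj (dA * dH) (gap c) * gap c))"

lemma psd_out: "psd (dA * dH) out"
  using \<Phi> psd_\<rho> by (simp add: out_def cptp_def)

lemma density_\<Phi>\<tau>: "i < N \<Longrightarrow> density dH (\<Phi> (\<tau> i))"
  using cptp_density[OF \<Phi> \<tau>] .

lemma \<Phi>\<tau>_carrier: "i < N \<Longrightarrow> \<Phi> (\<tau> i) \<in> carrier_mat dH dH"
  using density_\<Phi>\<tau> by (simp add: density_def psd_carrier)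

text \<open>The channel acts on each \<open>dK\<close>-block of \<rho>, and the block at (a,b) is
  the combination of the \<tau> with weights p times the (a,b) entry of \<sigma>. Linearity then
  gives the sum of p \<sigma> \<otimes> \<Phi>(\<tau>).\<close>

lemma out_index:
  assumes "a < dA" "b < dA" "k < dH" "l < dH"
  shows "out $$ (a * dH + k, b * dH + l) = (\<Sum>i<N. complex_of_real (p i) * \<sigma> i $$ (a,b) * \<Phi> (\<tau> i) $$ (k,l))"
proof -
  have lin: "Defs.linear_map dK dH \<Phi>" using \<Phi> by (simp add: cptp_def)
  have sc: "\<sigma> i \<in> carrier_mat dA dA" "\<tau> i \<in> carrier_mat dK dK" if "i < N" for i
    using \<sigma>[OF that] \<tau>[OF that] by (auto simp: density_def psd_carrier)
  have "block dK \<rho> a b = mat dK dK (\<lambda>(k,l). \<Sum>i<N. complex_of_real (p i) * \<sigma> i $$ (a,b) * \<tau> i $$ (k,l))"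
    using assms(1,2)
    by (intro eq_matI) (auto simp: block_def \<rho> mult_add_less kron_index[OF sc] mult.assoc intro!: sum.cong)
  then have "\<Phi> (block dK \<rho> a b) = mat dH dH (\<lambda>(k,l). \<Sum>i<N. complex_of_real (p i) * \<sigma> i $$ (a,b) * \<Phi> (\<tau> i) $$ (k,l))"
    using linear_map_sum[OF lin, of N \<tau> "\<lambda>i. complex_of_real (p i) * \<sigma> i $$ (a,b)"] sc by simp
  then show ?thesis using assms by (simp add: out_def id_tensor_def mult_add_less)
qed

lemma ptrace2_out:
  assumes "a < dA" "b < dA"
  shows "ptrace2 dA dH out $$ (a,b) = (\<Sum>i<N. complex_of_real (p i) * \<sigma> i $$ (a,b))"
proof -
  have "ptrace2 dA dH out $$ (a,b) = (\<Sum>k<dH. \<Sum>i<N. complex_of_real (p i) * \<sigma> i $$ (a,b) * \<Phi> (\<tau> i) $$ (k,k))"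
    using assms by (simp add: ptrace2_def out_index)
  also have "\<dots> = (\<Sum>i<N. \<Sum>k<dH. complex_of_real (p i) * \<sigma> i $$ (a,b) * \<Phi> (\<tau> i) $$ (k,k))"
    by (rule sum.swap)
  also have "\<dots> = (\<Sum>i<N. complex_of_real (p i) * \<sigma> i $$ (a,b) * mtrace (\<Phi> (\<tau> i)))"
    by (intro sum.cong refl) (simp add: mtrace_def sum_distrib_left carrier_matD(1)[OF \<Phi>\<tau>_carrier])
  also have "\<dots> = (\<Sum>i<N. complex_of_real (p i) * \<sigma> i $$ (a,b))"
    by (intro sum.cong refl) (use density_\<Phi>\<tau> in \<open>simp add: density_def\<close>)
  finally show ?thesis .
qed

lemma ptrace1_out:
  assumes "k < dH" "l < dH"
  shows "ptrace1 dA dH out $$ (k,l) = (\<Sum>i<N. complex_of_real (p i) * \<Phi> (\<tau> i) $$ (k,l))"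
proof -
  have s: "(\<Sum>a<dA. \<sigma> i $$ (a,a)) = 1" if "i < N" for i
    using \<sigma>[OF that] psd_carrier[of dA "\<sigma> i"] by (simp add: density_def mtrace_def)
  have "ptrace1 dA dH out $$ (k,l) = (\<Sum>a<dA. \<Sum>i<N. complex_of_real (p i) * \<sigma> i $$ (a,a) * \<Phi> (\<tau> i) $$ (k,l))"
    using assms by (simp add: ptrace1_def out_index)
  also have "\<dots> = (\<Sum>i<N. \<Sum>a<dA. complex_of_real (p i) * \<sigma> i $$ (a,a) * \<Phi> (\<tau> i) $$ (k,l))"
    by (rule sum.swap)
  also have "\<dots> = (\<Sum>i<N. complex_of_real (p i) * (\<Sum>a<dA. \<sigma> i $$ (a,a)) * \<Phi> (\<tau> i) $$ (k,l))"
    by (simp add: sum_distrib_left sum_distrib_right)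
  finally show ?thesis by (simp add: s)
qed

lemma out_carrier: "out \<in> carrier_mat (dA * dH) (dA * dH)"
  using psd_out by (rule psd_carrier)

lemma marg_carrier: "marg \<in> carrier_mat (dA * dH) (dA * dH)"
  unfolding marg_def by (rule kron_carrier) (simp_all add: ptrace1_def ptrace2_def)

lemma hermitian_gap: "hermitian (dA * dH) (gap c)"
proof -
  have o: "hermitian (dA * dH) out" using psd_out by (simp add: psd_def)
  have m: "hermitian (dA * dH) marg"
    unfolding marg_def by (intro hermitian_kron hermitian_ptrace1 hermitian_ptrace2 o)
  have "(complex_of_real c \<cdot>\<^sub>m marg) $$ (i,j) = cnj ((complex_of_real c \<cdot>\<^sub>m marg) $$ (j,i))"
    if ij: "i < dA * dH" "j < dA * dH" for i j
  proof -
    have "marg $$ (i,j) = cnj (marg $$ (j,i))" using m ij unfolding hermitian_iff by blast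
    then show ?thesis using ij marg_carrier by simp
  qed
  moreover have "complex_of_real c \<cdot>\<^sub>m marg \<in> carrier_mat (dA * dH) (dA * dH)"
    using marg_carrier by simp
  ultimately have "hermitian (dA * dH) (complex_of_real c \<cdot>\<^sub>m marg)"
    unfolding hermitian_iff by blast
  then show ?thesis unfolding gap_def by (rule hermitian_minus[OF o])
qed

lemma trace_out:
  assumes "P \<in> carrier_mat (dA * dH) (dA * dH)"
  shows "Re (mtrace (P * out)) = (\<Sum>i<N. p i * Re (mtrace (reduce dA dH (\<sigma> i) P * \<Phi> (\<tau> i))))"
  by (subst mtrace_mult_product_sum[OF assms out_carrier \<Phi>\<tau>_carrier out_index]) auto

text \<open>The product of the marginals corresponds to two independent draws of the index, so this
  trace is the average chance that the effect of one codeword fires on the output of an independent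
  one.\<close>

lemma trace_marg:
  assumes "P \<in> carrier_mat (dA * dH) (dA * dH)"
  shows "Re (mtrace (P * marg)) =
    (\<Sum>i<N. \<Sum>j<N. p i * p j * Re (mtrace (reduce dA dH (\<sigma> i) P * \<Phi> (\<tau> j))))"
proof -
  have c: "ptrace1 dA dH out \<in> carrier_mat dH dH" "ptrace2 dA dH out \<in> carrier_mat dA dA"
    by (simp_all add: ptrace1_def ptrace2_def)
  have "mtrace (P * marg) = (\<Sum>i<N. complex_of_real (p i) * mtrace (reduce dA dH (\<sigma> i) P * ptrace1 dA dH out))"
    by (rule mtrace_mult_product_sum[OF assms marg_carrier])
      (use c in \<open>auto simp: marg_def kron_index ptrace2_out sum_distrib_right\<close>)
  also have "\<dots> = (\<Sum>i<N. complex_of_real (p i) *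
      (\<Sum>j<N. complex_of_real (p j) * mtrace (reduce dA dH (\<sigma> i) P * \<Phi> (\<tau> j))))"
    by (subst mtrace_mult_lincomb[OF reduce_carrier c(1) \<Phi>\<tau>_carrier ptrace1_out]) auto
  finally show ?thesis by (simp add: sum_distrib_left mult.assoc)
qed

lemma trace_gap:
  assumes "P \<in> carrier_mat (dA * dH) (dA * dH)"
  shows "Re (mtrace (P * gap c)) = Re (mtrace (P * out)) - c * Re (mtrace (P * marg))"
proof -
  have g: "gap c \<in> carrier_mat (dA * dH) (dA * dH)" using hermitian_gap by (simp add: hermitian_def)
  have "mtrace (P * gap c) = mtrace (P * out) - complex_of_real c * mtrace (P * marg)"
    unfolding mtrace_mult[OF assms g] mtrace_mult[OF assms out_carrier] mtrace_mult[OF assms marg_carrier]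
    using out_carrier marg_carrier
    by (simp add: gap_def sum_distrib_left algebra_simps flip: sum_subtractf)
  then show ?thesis by simp
qed

lemma trace_reduce_bounds:
  assumes P: "effect (dA * dH) P" and "i < N" "j < N"
  shows "0 \<le> Re (mtrace (reduce dA dH (\<sigma> i) P * \<Phi> (\<tau> j)))"
    and "Re (mtrace (reduce dA dH (\<sigma> i) P * \<Phi> (\<tau> j))) \<le> 1"
proof -
  have e: "effect dH (reduce dA dH (\<sigma> i) P)" by (rule effect_reduce[OF \<sigma> P]) fact
  have w: "psd dH (\<Phi> (\<tau> j))" "mtrace (\<Phi> (\<tau> j)) = 1"
    using density_\<Phi>\<tau>[OF \<open>j < N\<close>] by (auto simp: density_def)
  show "0 \<le> Re (mtrace (reduce dA dH (\<sigma> i) P * \<Phi> (\<tau> j)))"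
    using e w by (intro mtrace_mult_nonneg) (auto simp: effect_def)
  show "Re (mtrace (reduce dA dH (\<sigma> i) P * \<Phi> (\<tau> j))) \<le> 1"
    using mtrace_mult_effect_le[OF w(1) e] mtrace_commute[OF reduce_carrier \<Phi>\<tau>_carrier[OF \<open>j < N\<close>]] w(2)
    by simp
qed

lemma trace_out_le: "effect (dA * dH) P \<Longrightarrow> Re (mtrace (P * out)) \<le> 1"
proof -
  assume P: "effect (dA * dH) P"
  then have c: "P \<in> carrier_mat (dA * dH) (dA * dH)" by (simp add: effect_def psd_carrier)
  have "Re (mtrace (P * out)) \<le> (\<Sum>i<N. p i)"
    unfolding trace_out[OF c] using trace_reduce_bounds(2)[OF P] p_nonneg
    by (intro sum_mono) (simp add: mult_left_le)
  then show ?thesis by (simp add: p_sum)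
qed

lemma trace_marg_nonneg: "effect (dA * dH) P \<Longrightarrow> 0 \<le> Re (mtrace (P * marg))"
proof -
  assume P: "effect (dA * dH) P"
  then have c: "P \<in> carrier_mat (dA * dH) (dA * dH)" by (simp add: effect_def psd_carrier)
  show ?thesis unfolding trace_marg[OF c]
    using trace_reduce_bounds(1)[OF P] p_nonneg by (intro sum_nonneg) simp
qed

text \<open>Dropping the nonnegative product term leaves an acceptance probability. This upper bound
  is what later upgrades a limit inferior equal to 1 to convergence.\<close>

lemma score_le_1:
  assumes "0 \<le> c"
  shows "score c \<le> 1"
proof -
  have P: "effect (dA * dH) (nonneg_proj (dA * dH) (gap c))"
    using nonneg_proj_optimal(1)[OF hermitian_gap] .
  then have c: "nonneg_proj (dA * dH) (gap c) \<in> carrier_mat (dA * dH) (dA * dH)"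
    by (simp add: effect_def psd_carrier)
  show ?thesis
    unfolding score_def trace_gap[OF c]
    using trace_out_le[OF P] mult_nonneg_nonneg[OF assms trace_marg_nonneg[OF P]] by simp
qed

text \<open>The converse uses optimality in this form: any test built from a decoder gives a lower
  bound on the score.\<close>

lemma score_ge:
  assumes T: "effect (dA * dH) T"
  shows "Re (mtrace (T * out)) - c * Re (mtrace (T * marg)) \<le> score c"
  using nonneg_proj_optimal(2)[OF hermitian_gap T, of c] T
  by (simp add: score_def trace_gap effect_def psd_carrier)

text \<open>The one-shot coding theorem. The decoder bound is averaged over codebooks: the
  missed-detection terms average to a multiple of 1 - Tr[P out], and each of the M - 1 competitors
  contributes a multiple of Tr[P marg].\<close>

lemma achieving_code:
  assumes M: "1 \<le> M" and Mc: "real M - 1 \<le> c"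
  shows "\<exists>\<rho>' E. is_code dK dH M \<rho>' E \<and> avg_error \<Phi> M \<rho>' E \<le> 14 * (1 - score c)"
proof -
  define P where "P = nonneg_proj (dA * dH) (gap c)"
  have P: "effect (dA * dH) P"
    unfolding P_def using nonneg_proj_optimal(1)[OF hermitian_gap] .
  then have Pc: "P \<in> carrier_mat (dA * dH) (dA * dH)" by (simp add: effect_def psd_carrier)
  define T where "T i = reduce dA dH (\<sigma> i) P" for i
  define \<alpha> where "\<alpha> i j = Re (mtrace (T i * \<Phi> (\<tau> j)))" for i j
  \<comment> \<open>The factors 6 and 8 are those of the measurement bound. In \<open>h\<close> the
    indices of \<open>\<alpha>\<close> are swapped, since interference for a sent codeword is the
    competitor's effect firing on the sent codeword's output.\<close>
  define g where "g i = 6 * (1 - \<alpha> i i)" for i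
  define h where "h i j = 8 * \<alpha> j i" for i j
  have T: "effect dH (T i)" if "i < N" for i
    unfolding T_def by (rule effect_reduce[OF \<sigma>[OF that] P])
  obtain x where x: "\<And>m. x m < N" and cost: "(\<Sum>m\<in>{1..M}. g (x m) + (\<Sum>m'\<in>{1..M}-{m}. h (x m) (x m'))) \<le>
     card {1..M} * (\<Sum>i<N. p i * g i) + card {1..M} * (real (card {1..M}) - 1) * (\<Sum>i<N. \<Sum>j<N. p i * p j * h i j)"
    using exists_codebook[OF p_nonneg p_sum, of "{1..M}" g h] by blast
  obtain E where E: "\<And>m. m \<in> {1..M} \<Longrightarrow> psd dH (E m)" "psd dH (1\<^sub>m dH - matsum dH {1..M} E)"
    and bound: "\<And>m f. m \<in> {1..M} \<Longrightarrow> sqnorm dH f - Re (qform dH (E m) f) \<le>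
      6 * (sqnorm dH f - Re (qform dH (T (x m)) f)) + 8 * (\<Sum>m'\<in>{1..M}-{m}. Re (qform dH (T (x m')) f))"
    using resolvent_measurement[of "{1..M}" dH "\<lambda>m. T (x m)"] T x by auto
  define \<rho>' where "\<rho>' m = \<tau> (x m)" for m
  have code: "is_code dK dH M \<rho>' E"
    unfolding is_code_def using M E \<tau>[OF x] by (simp add: \<rho>'_def matsum_def)
  have err: "1 - Re (mtrace (\<Phi> (\<rho>' m) * E m)) \<le> g (x m) + (\<Sum>m'\<in>{1..M}-{m}. h (x m) (x m'))"
    if m: "m \<in> {1..M}" for m
  proof -
    let ?W = "\<Phi> (\<tau> (x m))"
    have W: "psd dH ?W" "mtrace ?W = 1" using density_\<Phi>\<tau>[OF x[of m]] by (auto simp: density_def)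
    have Wc: "?W \<in> carrier_mat dH dH" using W(1) by (rule psd_carrier)
    \<comment> \<open>Decomposing the output state turns the decoder bound for quadratic forms into
      a bound on the error probability.\<close>
    obtain u where u: "\<And>B. B \<in> carrier_mat dH dH \<Longrightarrow> mtrace (?W * B) = (\<Sum>k<dH. qform dH B (u k))"
      using psd_trace_qform[OF W(1)] by blast
    have one: "(\<Sum>k<dH. sqnorm dH (u k)) = 1"
      using u[of "1\<^sub>m dH"] Wc W(2) by (simp add: qform_one flip: of_real_sum)
    have al: "\<alpha> i (x m) = (\<Sum>k<dH. Re (qform dH (T i) (u k)))" for i
      unfolding \<alpha>_def mtrace_commute[OF reduce_carrier[of dA dH "\<sigma> i" P, folded T_def] Wc]
      by (simp add: u T_def)
    have "1 - Re (mtrace (?W * E m)) = (\<Sum>k<dH. sqnorm dH (u k) - Re (qform dH (E m) (u k)))"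
      using u[OF psd_carrier[OF E(1)[OF m]]] one by (simp add: sum_subtractf)
    also have "\<dots> \<le> (\<Sum>k<dH. 6 * (sqnorm dH (u k) - Re (qform dH (T (x m)) (u k))) +
        8 * (\<Sum>m'\<in>{1..M}-{m}. Re (qform dH (T (x m')) (u k))))"
      by (intro sum_mono bound m)
    also have "\<dots> = 6 * (1 - \<alpha> (x m) (x m)) + 8 * (\<Sum>k<dH. \<Sum>m'\<in>{1..M}-{m}. Re (qform dH (T (x m')) (u k)))"
      by (simp add: sum.distrib sum_subtractf one al flip: sum_distrib_left)
    also have "(\<Sum>k<dH. \<Sum>m'\<in>{1..M}-{m}. Re (qform dH (T (x m')) (u k))) = (\<Sum>m'\<in>{1..M}-{m}. \<alpha> (x m') (x m))"
      unfolding al by (rule sum.swap)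
    finally show ?thesis by (simp add: g_def h_def \<rho>'_def sum_distrib_left)
  qed
  define A where "A = Re (mtrace (P * out))"
  define B where "B = Re (mtrace (P * marg))"
  have gA: "(\<Sum>i<N. p i * g i) = 6 * (1 - A)"
  proof -
    have "(\<Sum>i<N. p i * g i) = (\<Sum>i<N. 6 * p i - 6 * (p i * \<alpha> i i))"
      by (intro sum.cong refl) (simp add: g_def algebra_simps)
    also have "\<dots> = 6 * (\<Sum>i<N. p i) - 6 * (\<Sum>i<N. p i * \<alpha> i i)"
      by (simp add: sum_subtractf sum_distrib_left)
    finally show ?thesis by (simp add: p_sum A_def trace_out[OF Pc] \<alpha>_def T_def)
  qed
  have hB: "(\<Sum>i<N. \<Sum>j<N. p i * p j * h i j) = 8 * B"
  proof -
    have "(\<Sum>i<N. \<Sum>j<N. p i * p j * h i j) = (\<Sum>j<N. \<Sum>i<N. p i * p j * h i j)" by (rule sum.swap)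
    also have "\<dots> = 8 * B"
      unfolding B_def trace_marg[OF Pc] h_def \<alpha>_def T_def sum_distrib_left
      by (intro sum.cong refl) (simp add: mult_ac)
    finally show ?thesis .
  qed
  have "avg_error \<Phi> M \<rho>' E \<le> (1 / real M) * (\<Sum>m\<in>{1..M}. g (x m) + (\<Sum>m'\<in>{1..M}-{m}. h (x m) (x m')))"
    unfolding avg_error_def using err by (intro mult_left_mono sum_mono) auto
  also have "\<dots> \<le> (1 / real M) * (real M * (6 * (1 - A)) + real M * (real M - 1) * (8 * B))"
    using cost unfolding gA hB by (intro mult_left_mono) auto
  also have "\<dots> = 6 * (1 - A) + 8 * ((real M - 1) * B)"
    using M by (simp add: field_simps)
  \<comment> \<open>Here the codebook size enters: the number M - 1 of competitors is at most
    \<open>c\<close>.\<close>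
  also have "\<dots> \<le> 6 * (1 - A) + 8 * (c * B)"
    using mult_right_mono[OF Mc trace_marg_nonneg[OF P]] by (simp add: B_def)
  also have "\<dots> \<le> 14 * (1 - score c)"
  proof -
    \<comment> \<open>The constant is 14 = 6 + 8: both 1 - a and b are nonnegative, so each can be
      given the full weight.\<close>
    have bound: "6 * (1 - a) + 8 * b \<le> 14 * (1 - (a - b))" if "a \<le> 1" "0 \<le> b" for a b :: real
      using that by simp
    have sc: "score c = A - c * B" unfolding score_def A_def B_def P_def[symmetric] by (rule trace_gap[OF Pc])
    show ?thesis unfolding sc
    proof (rule bound)
      show "A \<le> 1" unfolding A_def by (rule trace_out_le[OF P])
      show "0 \<le> c * B"
        using M Mc trace_marg_nonneg[OF P] by (intro mult_nonneg_nonneg) (auto simp: B_def)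
    qed
  qed
  finally show ?thesis using code by blast
qed

end

section \<open>Capacity\<close>

definition blockdiag :: "nat \<Rightarrow> nat \<Rightarrow> (nat \<Rightarrow> complex mat) \<Rightarrow> complex mat" where
  "blockdiag n d B = mat (n * d) (n * d)
     (\<lambda>(i,j). if i div d = j div d then B (i div d) $$ (i mod d, j mod d) else 0)"

lemma blockdiag_carrier [simp]: "blockdiag n d B \<in> carrier_mat (n * d) (n * d)"
  by (simp add: blockdiag_def)

lemma blockdiag_index:
  assumes "a < n" "b < n" "k < d" "l < d"
  shows "blockdiag n d B $$ (a * d + k, b * d + l) = (if a = b then B a $$ (k,l) else 0)"
  using assms by (simp add: blockdiag_def mult_add_less)

lemma qform_blockdiag: "qform (n * d) (blockdiag n d B) f = (\<Sum>a<n. qform d (B a) (\<lambda>k. f (a * d + k)))"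
proof -
  have "qform (n * d) (blockdiag n d B) f = (\<Sum>a<n. \<Sum>k<d. \<Sum>b<n.
      if b = a then \<Sum>l<d. cnj (f (a * d + k)) * B a $$ (k,l) * f (a * d + l) else 0)"
    unfolding qform_def sum_lessThan_mult by (intro sum.cong refl) (simp add: blockdiag_index)
  then show ?thesis by (simp add: qform_def)
qed

lemma hermitian_blockdiag:
  assumes "\<And>a. a < n \<Longrightarrow> hermitian d (B a)"
  shows "hermitian (n * d) (blockdiag n d B)"
  unfolding hermitian_iff
proof (intro conjI allI impI)
  fix i j assume ij: "i < n * d" "j < n * d"
  note i = div_mod_less[OF ij(1)] and j = div_mod_less[OF ij(2)]
  have "B (i div d) $$ (i mod d, j mod d) = cnj (B (i div d) $$ (j mod d, i mod d))"
    using assms[OF i(1)] i j unfolding hermitian_iff by blast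
  then show "blockdiag n d B $$ (i,j) = cnj (blockdiag n d B $$ (j,i))"
    using ij by (cases "i div d = j div d") (auto simp: blockdiag_def)
qed simp

lemma psd_blockdiag:
  assumes "\<And>a. a < n \<Longrightarrow> psd d (B a)"
  shows "psd (n * d) (blockdiag n d B)"
  using assms hermitian_blockdiag[of n d B] by (auto simp: psd_iff qform_blockdiag intro!: sum_nonneg)

lemma effect_blockdiag:
  assumes "\<And>a. a < n \<Longrightarrow> effect d (B a)"
  shows "effect (n * d) (blockdiag n d B)"
proof -
  have "sqnorm (n * d) f = (\<Sum>a<n. sqnorm d (\<lambda>k. f (a * d + k)))" for f
    unfolding sqnorm_def sum_lessThan_mult ..
  then show ?thesis using assms hermitian_blockdiag[of n d B]
    by (auto simp: effect_iff qform_blockdiag intro!: sum_nonneg sum_mono)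
qed

section \<open>Acceptance and error bounds of a code\<close>

lemma is_code_qform_le:
  assumes "is_code dK dH M \<rho> E"
  shows "(\<Sum>m=1..M. Re (qform dH (E m) f)) \<le> sqnorm dH f"
proof -
  have "psd dH (1\<^sub>m dH - matsum dH {1..M} E)" using assms by (simp add: is_code_def matsum_def)
  from psdD[OF this, of f] show ?thesis
    by (simp add: qform_minus qform_one qform_matsum)
qed

lemma is_code_effect:
  assumes "is_code dK dH M \<rho> E" "m \<in> {1..M}"
  shows "effect dH (E m)"
proof -
  have E: "psd dH (E m)" if "m \<in> {1..M}" for m using assms(1) that by (simp add: is_code_def)
  have "Re (qform dH (E m) f) \<le> sqnorm dH f" for f
  proof -
    have "Re (qform dH (E m) f) \<le> (\<Sum>m=1..M. Re (qform dH (E m) f))"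
      using assms(2) psdD[OF E] by (intro member_le_sum) auto
    then show ?thesis using is_code_qform_le[OF assms(1), of f] by simp
  qed
  then show ?thesis using E[OF assms(2)] by (simp add: effect_iff psd_iff)
qed

text \<open>Decomposing \<open>W\<close> into vectors reduces this to the operator bound on the sum
  of the \<open>E m\<close>. In the converse it limits how often the decoder's test accepts the
  product of the marginals.\<close>

lemma is_code_trace_le:
  assumes "is_code dK dH M \<rho> E" "density dH W"
  shows "(\<Sum>m=1..M. Re (mtrace (W * E m))) \<le> 1"
proof -
  have W: "psd dH W" "mtrace W = 1" using assms(2) by (auto simp: density_def)
  obtain u where u: "\<And>B. B \<in> carrier_mat dH dH \<Longrightarrow> mtrace (W * B) = (\<Sum>k<dH. qform dH B (u k))"
    using psd_trace_qform[OF W(1)] by blast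
  have one: "(\<Sum>k<dH. sqnorm dH (u k)) = 1"
    using u[of "1\<^sub>m dH"] psd_carrier[OF W(1)] W(2) by (simp add: qform_one flip: of_real_sum)
  have E: "E m \<in> carrier_mat dH dH" if "m \<in> {1..M}" for m
    using is_code_effect[OF assms(1) that] by (simp add: effect_def psd_carrier)
  have "(\<Sum>m=1..M. Re (mtrace (W * E m))) = (\<Sum>m=1..M. \<Sum>k<dH. Re (qform dH (E m) (u k)))"
    by (intro sum.cong refl) (simp add: u E)
  also have "\<dots> = (\<Sum>k<dH. \<Sum>m=1..M. Re (qform dH (E m) (u k)))" by (rule sum.swap)
  also have "\<dots> \<le> (\<Sum>k<dH. sqnorm dH (u k))"
    by (intro sum_mono is_code_qform_le[OF assms(1)])
  finally show ?thesis by (simp add: one)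
qed

lemma avg_error_nonneg:
  assumes \<Phi>: "cptp dK dH \<Phi>" and code: "is_code dK dH M \<rho> E"
  shows "0 \<le> avg_error \<Phi> M \<rho> E"
proof -
  have "Re (mtrace (\<Phi> (\<rho> m) * E m)) \<le> 1" if m: "m \<in> {1..M}" for m
  proof -
    have "density dH (\<Phi> (\<rho> m))" using code m by (intro cptp_density[OF \<Phi>]) (simp add: is_code_def)
    then show ?thesis using mtrace_mult_effect_le[OF _ is_code_effect[OF code m], of "\<Phi> (\<rho> m)"]
      by (simp add: density_def)
  qed
  then show ?thesis unfolding avg_error_def by (intro mult_nonneg_nonneg sum_nonneg) auto
qed

text \<open>The term inside the limit inferior at one \<open>n\<close>, with the exponential factor
  abstracted to \<open>c\<close>; this allows one-shot statements for arbitrary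
  \<open>c\<close>.\<close>

definition spec_score :: "nat \<Rightarrow> nat \<Rightarrow> complex mat \<Rightarrow> real \<Rightarrow> real" where
  "spec_score dX dY R c =
    (let Pg = R - complex_of_real c \<cdot>\<^sub>m kron (ptrace2 dX dY R) (ptrace1 dX dY R)
     in Re (mtrace (nonneg_proj (dX * dY) Pg * Pg)))"

lemma inf_spec_MI_eq:
  "inf_spec_MI dX dY R = Sup (ereal ` {\<gamma>.
     liminf (\<lambda>n. ereal (spec_score (dX n) (dY n) (R n) (exp (real n * \<gamma>)))) = 1})"
  by (simp add: inf_spec_MI_def spec_score_def Let_def)

lemma (in separable_input) score_eq: "score c = spec_score dA dH (id_tensor dA dK dH \<Phi> \<rho>) c"
  by (simp add: score_def gap_def marg_def out_def spec_score_def Let_def)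

lemma separable_inputE:
  assumes "cptp dK dH \<Phi>" "density (dA * dK) \<rho>" "separable dA dK \<rho>"
  obtains N p \<sigma> \<tau> where "separable_input dA dK dH N \<Phi> p \<sigma> \<tau> \<rho>"
proof -
  obtain N :: nat and p :: "nat \<Rightarrow> real" and \<sigma> \<tau> where
    "\<forall>i<N. 0 \<le> p i \<and> density dA (\<sigma> i) \<and> density dK (\<tau> i)" "(\<Sum>i<N. p i) = 1"
    "\<rho> = mat (dA*dK) (dA*dK) (\<lambda>(r,c). \<Sum>i<N. complex_of_real (p i) * kron (\<sigma> i) (\<tau> i) $$ (r,c))"
    using assms(3) unfolding separable_def by blast
  then have "separable_input dA dK dH N \<Phi> p \<sigma> \<tau> \<rho>"
    using assms by unfold_locales (auto simp: density_def)
  then show ?thesis by (rule that)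
qed

text \<open>The one-shot converse. The decoder's test accepts the joint output with probability 1 -
  P_e and the product of the marginals with probability at most 1/M, and optimality of the
  projection gives the lower bound. The state is chosen before \<open>c\<close>, so one state serves
  every threshold.\<close>

lemma code_state:
  assumes \<Phi>: "cptp dK dH \<Phi>" and code: "is_code dK dH M \<rho>' E"
  obtains \<rho> where "density (M * dK) \<rho>" "separable M dK \<rho>"
    "\<And>c. 0 \<le> c \<Longrightarrow> spec_score M dH (id_tensor M dK dH \<Phi> \<rho>) c \<in> {1 - avg_error \<Phi> M \<rho>' E - c / real M .. 1}"
proof -
  have M: "1 \<le> M" using code by (simp add: is_code_def)
  define p where "p = (\<lambda>_::nat. 1 / real M)"
  define \<sigma> where "\<sigma> i = mat M M (\<lambda>(a,b). if a = i \<and> b = i then 1 else 0 :: complex)" for i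
  \<comment> \<open>Messages of a code are numbered from 1, members of the ensemble from 0.\<close>
  define \<tau> where "\<tau> i = \<rho>' (Suc i)" for i
  define \<rho> where "\<rho> = mat (M*dK) (M*dK) (\<lambda>(r,c). \<Sum>i<M. complex_of_real (p i) * kron (\<sigma> i) (\<tau> i) $$ (r,c))"
  have \<tau>: "density dK (\<tau> i)" if "i < M" for i using code that by (simp add: is_code_def \<tau>_def)
  have \<tau>c: "\<tau> i \<in> carrier_mat dK dK" if "i < M" for i using \<tau>[OF that] by (simp add: density_def psd_carrier)
  have \<sigma>c: "\<sigma> i \<in> carrier_mat M M" for i by (simp add: \<sigma>_def)
  have \<sigma>: "density M (\<sigma> i)" if i: "i < M" for i
  proof -
    have "qform M (\<sigma> i) f = (\<Sum>a<M. \<Sum>b<M. if b = i then (if a = i then cnj (f i) * f i else 0) else 0)" for f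
      unfolding qform_def by (intro sum.cong refl) (auto simp: \<sigma>_def)
    then have "qform M (\<sigma> i) f = cnj (f i) * f i" for f using i by simp
    then have "0 \<le> Re (qform M (\<sigma> i) f)" for f by simp
    moreover have "hermitian M (\<sigma> i)" by (auto simp: hermitian_iff \<sigma>_def)
    moreover have "mtrace (\<sigma> i) = 1"
    proof -
      have "mtrace (\<sigma> i) = (\<Sum>a<M. if a = i then 1 else 0)"
        unfolding mtrace_def by (intro sum.cong) (auto simp: \<sigma>_def)
      then show ?thesis using i by simp
    qed
    ultimately show ?thesis by (simp add: density_def psd_iff)
  qed
  have p: "\<And>i. 0 \<le> p i" "(\<Sum>i<M. p i) = 1" using M by (auto simp: p_def)
  \<comment> \<open>Since each \<sigma> is a basis projector, the state is block diagonal, and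
    positivity and trace are read off from the blocks.\<close>
  have \<rho>_block: "\<rho> = blockdiag M dK (\<lambda>a. complex_of_real (1 / real M) \<cdot>\<^sub>m \<tau> a)"
  proof (rule eq_matI)
    fix i j assume "i < dim_row (blockdiag M dK (\<lambda>a. complex_of_real (1 / real M) \<cdot>\<^sub>m \<tau> a))"
      "j < dim_col (blockdiag M dK (\<lambda>a. complex_of_real (1 / real M) \<cdot>\<^sub>m \<tau> a))"
    then have ij: "i < M * dK" "j < M * dK" by (auto simp: blockdiag_def)
    note i = div_mod_less[OF ij(1)] and j = div_mod_less[OF ij(2)]
    have "\<rho> $$ (i,j) = (\<Sum>m<M. complex_of_real (p m) * kron (\<sigma> m) (\<tau> m) $$ (i div dK * dK + i mod dK, j div dK * dK + j mod dK))"
      using ij by (simp add: \<rho>_def)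
    also have "\<dots> = (\<Sum>m<M. complex_of_real (p m) * (\<sigma> m $$ (i div dK, j div dK) * \<tau> m $$ (i mod dK, j mod dK)))"
    proof (intro sum.cong refl)
      fix m assume "m \<in> {..<M}"
      then show "complex_of_real (p m) * kron (\<sigma> m) (\<tau> m) $$ (i div dK * dK + i mod dK, j div dK * dK + j mod dK) =
          complex_of_real (p m) * (\<sigma> m $$ (i div dK, j div dK) * \<tau> m $$ (i mod dK, j mod dK))"
        using kron_index[OF \<sigma>c \<tau>c i(1) j(1) i(2) j(2), of m m] by simp
    qed
    also have "\<dots> = (\<Sum>m<M. if m = i div dK then (if i div dK = j div dK then
        complex_of_real (1 / real M) * \<tau> (i div dK) $$ (i mod dK, j mod dK) else 0) else 0)"
      using i j by (intro sum.cong refl) (auto simp: \<sigma>_def p_def)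
    also have "\<dots> = blockdiag M dK (\<lambda>a. complex_of_real (1 / real M) \<cdot>\<^sub>m \<tau> a) $$ (i,j)"
    proof -
      have "(complex_of_real (1 / real M) \<cdot>\<^sub>m \<tau> (i div dK)) $$ (i mod dK, j mod dK) =
          complex_of_real (1 / real M) * \<tau> (i div dK) $$ (i mod dK, j mod dK)"
        using \<tau>c[OF i(1)] i j by (intro index_smult_mat) auto
      then show ?thesis using ij i(1) by (cases "i div dK = j div dK") (auto simp: blockdiag_def)
    qed
    finally show "\<rho> $$ (i,j) = blockdiag M dK (\<lambda>a. complex_of_real (1 / real M) \<cdot>\<^sub>m \<tau> a) $$ (i,j)" .
  qed (simp_all add: \<rho>_def blockdiag_def)
  have psd_\<rho>: "psd (M * dK) \<rho>"
    unfolding \<rho>_block using \<tau> by (intro psd_blockdiag psd_smult) (auto simp: density_def)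
  have "mtrace \<rho> = (\<Sum>a<M. \<Sum>k<dK. complex_of_real (1 / real M) * \<tau> a $$ (k,k))"
    unfolding \<rho>_block mtrace_def
    by (simp add: carrier_matD(1)[OF blockdiag_carrier] sum_lessThan_mult blockdiag_index
        index_smult_mat(1) carrier_matD[OF \<tau>c])
  also have "\<dots> = (\<Sum>a<M. complex_of_real (1 / real M) * mtrace (\<tau> a))"
    by (intro sum.cong refl) (simp add: mtrace_def sum_distrib_left carrier_matD(1)[OF \<tau>c])
  also have "\<dots> = 1" using \<tau> M by (simp add: density_def)
  finally have dens: "density (M * dK) \<rho>" using psd_\<rho> by (simp add: density_def)
  interpret separable_input M dK dH M \<Phi> p \<sigma> \<tau> \<rho>
    by unfold_locales (use \<Phi> p \<sigma> \<tau> psd_\<rho> \<rho>_def in auto)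
  have sep: "separable M dK \<rho>"
    unfolding separable_def using p \<sigma> \<tau> \<rho>_def by blast
  define T where "T = blockdiag M dH (\<lambda>a. E (Suc a))"
  have T: "effect (M * dH) T"
    unfolding T_def by (rule effect_blockdiag) (use is_code_effect[OF code] in simp)
  have Tc: "T \<in> carrier_mat (M * dH) (M * dH)" by (simp add: T_def)
  have Ec: "E (Suc i) \<in> carrier_mat dH dH" if "i < M" for i
    using is_code_effect[OF code, of "Suc i"] that by (simp add: effect_def psd_carrier)
  \<comment> \<open>Reducing against a basis projector picks out the corresponding diagonal block of
    the test.\<close>
  have red: "reduce M dH (\<sigma> i) T = E (Suc i)" if i: "i < M" for i
  proof (rule eq_matI)
    fix k l assume "k < dim_row (E (Suc i))" "l < dim_col (E (Suc i))"
    then have kl: "k < dH" "l < dH" using Ec[OF i] by auto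
    have "reduce M dH (\<sigma> i) T $$ (k,l) = (\<Sum>a<M. \<Sum>b<M. if b = i then (if a = i then E (Suc i) $$ (k,l) else 0) else 0)"
    proof -
      have "reduce M dH (\<sigma> i) T $$ (k,l) = (\<Sum>a<M. \<Sum>b<M. \<sigma> i $$ (b,a) * T $$ (a * dH + k, b * dH + l))"
        using kl by (simp add: reduce_def)
      also have "\<dots> = (\<Sum>a<M. \<Sum>b<M. if b = i then (if a = i then E (Suc i) $$ (k,l) else 0) else 0)"
        using kl by (intro sum.cong refl) (auto simp: T_def blockdiag_index \<sigma>_def)
      finally show ?thesis .
    qed
    then show "reduce M dH (\<sigma> i) T $$ (k,l) = E (Suc i) $$ (k,l)" using i by simp
  qed (use Ec[OF i] in \<open>simp_all add: reduce_def\<close>)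
  have comm: "mtrace (E (Suc i) * \<Phi> (\<tau> j)) = mtrace (\<Phi> (\<tau> j) * E (Suc i))" if "i < M" "j < M" for i j
    by (rule mtrace_commute) (use Ec \<Phi>\<tau>_carrier that in auto)
  have tr_out: "Re (mtrace (T * out)) = 1 - avg_error \<Phi> M \<rho>' E"
  proof -
    have "Re (mtrace (T * out)) = (\<Sum>i<M. 1 / real M * Re (mtrace (\<Phi> (\<rho>' (Suc i)) * E (Suc i))))"
      unfolding trace_out[OF Tc] by (intro sum.cong refl) (simp add: red comm p_def, simp add: \<tau>_def)
    also have "\<dots> = 1 / real M * (\<Sum>m=1..M. Re (mtrace (\<Phi> (\<rho>' m) * E m)))"
      by (simp add: sum.atLeast1_atMost_eq sum_distrib_left)
    also have "\<dots> = 1 - avg_error \<Phi> M \<rho>' E"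
      using M by (simp add: avg_error_def sum_subtractf right_diff_distrib)
    finally show ?thesis .
  qed
  \<comment> \<open>For each fixed output state the decoder elements contribute at most 1 in total,
    so M output states of weight 1/M^2 give 1/M.\<close>
  have tr_marg: "Re (mtrace (T * marg)) \<le> 1 / real M"
  proof -
    have "Re (mtrace (T * marg)) = (\<Sum>i<M. \<Sum>j<M. 1 / (real M)\<^sup>2 * Re (mtrace (\<Phi> (\<tau> j) * E (Suc i))))"
      unfolding trace_marg[OF Tc]
      by (intro sum.cong refl) (simp add: red comm p_def power2_eq_square)
    also have "\<dots> = (\<Sum>j<M. \<Sum>i<M. 1 / (real M)\<^sup>2 * Re (mtrace (\<Phi> (\<tau> j) * E (Suc i))))"
      by (rule sum.swap)
    also have "\<dots> = (\<Sum>j<M. 1 / (real M)\<^sup>2 * (\<Sum>m=1..M. Re (mtrace (\<Phi> (\<tau> j) * E m))))"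
      by (simp add: sum.atLeast1_atMost_eq sum_distrib_left)
    also have "\<dots> \<le> (\<Sum>j<M. 1 / (real M)\<^sup>2 * 1)"
      using is_code_trace_le[OF code density_\<Phi>\<tau>] by (intro sum_mono mult_left_mono) auto
    also have "\<dots> = 1 / real M" using M by (simp add: power2_eq_square)
    finally show ?thesis .
  qed
  show ?thesis
  proof (rule that[OF dens sep])
    fix c :: real assume c: "0 \<le> c"
    have "1 - avg_error \<Phi> M \<rho>' E - c / real M \<le> Re (mtrace (T * out)) - c * Re (mtrace (T * marg))"
      using mult_left_mono[OF tr_marg c] by (simp add: tr_out)
    also have "\<dots> \<le> score c" by (rule score_ge[OF T])
    finally show "spec_score M dH (id_tensor M dK dH \<Phi> \<rho>) c \<in> {1 - avg_error \<Phi> M \<rho>' E - c / real M .. 1}"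
      using score_le_1[OF c] by (simp add: score_eq)
  qed
qed

text \<open>The one-shot error bound is a multiple of 1 - score, and the score tends to 1 at the
  rate \<gamma> itself. No slack in the rate is lost.\<close>

lemma achievable_of_spec_score:
  fixes dA dK dH :: "nat \<Rightarrow> nat"
  assumes \<Lambda>: "\<And>n. n \<ge> 1 \<Longrightarrow> cptp (dK n) (dH n) (\<Lambda> n)"
    and \<rho>: "\<And>n. n \<ge> 1 \<Longrightarrow> density (dA n * dK n) (\<rho> n) \<and> separable (dA n) (dK n) (\<rho> n)"
    and lim: "liminf (\<lambda>n. ereal (spec_score (dA n) (dH n) (id_tensor (dA n) (dK n) (dH n) (\<Lambda> n) (\<rho> n))
       (exp (real n * \<gamma>)))) = 1"
  shows "achievable dK dH \<Lambda> \<gamma>"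
proof -
  define x where "x n = spec_score (dA n) (dH n) (id_tensor (dA n) (dK n) (dH n) (\<Lambda> n) (\<rho> n)) (exp (real n * \<gamma>))" for n
  \<comment> \<open>Rounding up meets the rate requirement, while M - 1 stays below e^(n \<gamma>)
    as \<open>achieving_code\<close> demands.\<close>
  define M where "M n = nat \<lceil>exp (real n * \<gamma>)\<rceil>" for n
  have M: "1 \<le> M n" "exp (real n * \<gamma>) \<le> real (M n)" "real (M n) - 1 \<le> exp (real n * \<gamma>)" for n
  proof -
    have "0 < \<lceil>exp (real n * \<gamma>)\<rceil>" by simp
    then show "1 \<le> M n" unfolding M_def by linarith
    show "exp (real n * \<gamma>) \<le> real (M n)" unfolding M_def by (rule real_nat_ceiling_ge)
    show "real (M n) - 1 \<le> exp (real n * \<gamma>)"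
      unfolding M_def using \<open>0 < \<lceil>exp (real n * \<gamma>)\<rceil>\<close> by linarith
  qed
  have "x n \<le> 1 \<and> (\<exists>\<rho>' E. is_code (dK n) (dH n) (M n) \<rho>' E \<and> avg_error (\<Lambda> n) (M n) \<rho>' E \<le> 14 * (1 - x n))"
    if n: "n \<ge> 1" for n
  proof -
    obtain N p \<sigma> \<tau> where "separable_input (dA n) (dK n) (dH n) N (\<Lambda> n) p \<sigma> \<tau> (\<rho> n)"
      using separable_inputE[OF \<Lambda>[OF n]] \<rho>[OF n] by blast
    then interpret separable_input "dA n" "dK n" "dH n" N "\<Lambda> n" p \<sigma> \<tau> "\<rho> n" .
    have "score (exp (real n * \<gamma>)) = x n" by (simp add: score_eq x_def)
    then show ?thesis
      using achieving_code[OF M(1) M(3), of n] score_le_1[of "exp (real n * \<gamma>)"] by simp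
  qed
  \<comment> \<open>The guard n \<ge> 1 is moved under the existential quantifiers, so that codes
    can be chosen as functions of all \<open>n\<close>, arbitrary at 0.\<close>
  then have x1: "\<And>n. n \<ge> 1 \<Longrightarrow> x n \<le> 1"
    and "\<forall>n. \<exists>\<rho>' E. n \<ge> 1 \<longrightarrow> is_code (dK n) (dH n) (M n) \<rho>' E \<and> avg_error (\<Lambda> n) (M n) \<rho>' E \<le> 14 * (1 - x n)"
    by blast+
  then obtain \<rho>' E where code: "\<And>n. n \<ge> 1 \<Longrightarrow> is_code (dK n) (dH n) (M n) (\<rho>' n) (E n)"
    and err: "\<And>n. n \<ge> 1 \<Longrightarrow> avg_error (\<Lambda> n) (M n) (\<rho>' n) (E n) \<le> 14 * (1 - x n)"
    by metis
  \<comment> \<open>A limit inferior of 1 together with the upper bound 1 forces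
    convergence.\<close>
  have "limsup (\<lambda>n. ereal (x n)) \<le> 1"
    by (rule Limsup_bounded) (auto simp: eventually_sequentially one_ereal_def intro!: exI[of _ 1] x1)
  moreover have "liminf (\<lambda>n. ereal (x n)) = 1" using lim by (simp add: x_def)
  moreover have "liminf (\<lambda>n. ereal (x n)) \<le> limsup (\<lambda>n. ereal (x n))"
    by (rule Liminf_le_Limsup) simp
  ultimately have "(\<lambda>n. ereal (x n)) \<longlonglongrightarrow> 1"
    by (intro iffD2[OF tendsto_iff_Liminf_eq_Limsup]) auto
  then have "x \<longlonglongrightarrow> 1" by (simp add: one_ereal_def)
  then have lim0: "(\<lambda>n. 14 * (1 - x n)) \<longlonglongrightarrow> 0"
    by (auto intro!: tendsto_eq_intros)
  have "(\<lambda>n. avg_error (\<Lambda> n) (M n) (\<rho>' n) (E n)) \<longlonglongrightarrow> 0"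
  proof (rule tendsto_sandwich[OF _ _ tendsto_const lim0])
    show "\<forall>\<^sub>F n in sequentially. 0 \<le> avg_error (\<Lambda> n) (M n) (\<rho>' n) (E n)"
      using avg_error_nonneg[OF \<Lambda> code] by (auto simp: eventually_sequentially)
    show "\<forall>\<^sub>F n in sequentially. avg_error (\<Lambda> n) (M n) (\<rho>' n) (E n) \<le> 14 * (1 - x n)"
      using err by (auto simp: eventually_sequentially)
  qed
  then show ?thesis
    unfolding achievable_def using code M(2) by (intro exI[of _ M] exI[of _ \<rho>'] exI[of _ E]) auto
qed

text \<open>The states built from the codes are the same for all \<gamma>. For \<gamma> < R the loss
  e^(n \<gamma>) / M is at most e^(-n (R - \<gamma>)) and vanishes; the supremum over such \<gamma>
  then reaches \<open>R\<close>.\<close>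

lemma achievable_le_inf_spec_MI:
  assumes \<Lambda>: "\<And>n. n \<ge> 1 \<Longrightarrow> cptp (dK n) (dH n) (\<Lambda> n)" and R: "achievable dK dH \<Lambda> R"
  obtains dA \<rho> where "\<And>n. n \<ge> 1 \<Longrightarrow> 0 < dA n \<and> density (dA n * dK n) (\<rho> n) \<and> separable (dA n) (dK n) (\<rho> n)"
    "ereal R \<le> inf_spec_MI dA dH (\<lambda>n. id_tensor (dA n) (dK n) (dH n) (\<Lambda> n) (\<rho> n))"
proof -
  obtain M :: "nat \<Rightarrow> nat" and \<rho>' E where code: "\<And>n. n \<ge> 1 \<Longrightarrow> is_code (dK n) (dH n) (M n) (\<rho>' n) (E n)"
    and rate: "\<forall>\<^sub>F n in sequentially. exp (real n * R) \<le> real (M n)"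
    and err: "(\<lambda>n. avg_error (\<Lambda> n) (M n) (\<rho>' n) (E n)) \<longlonglongrightarrow> 0"
    using R unfolding achievable_def by blast
  \<comment> \<open>The bound is recorded for all c \<ge> 0, so that the choice of the states
    precedes that of \<gamma>.\<close>
  define good where "good n \<rho> \<longleftrightarrow> density (M n * dK n) \<rho> \<and> separable (M n) (dK n) \<rho> \<and>
    (\<forall>c\<ge>0. spec_score (M n) (dH n) (id_tensor (M n) (dK n) (dH n) (\<Lambda> n) \<rho>) c
      \<in> {1 - avg_error (\<Lambda> n) (M n) (\<rho>' n) (E n) - c / real (M n) .. 1})" for n \<rho>
  have "\<exists>\<rho>. good n \<rho>" if n: "n \<ge> 1" for n
    using code_state[OF \<Lambda>[OF n] code[OF n]] unfolding good_def by metis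
  then obtain \<rho> where good: "\<And>n. n \<ge> 1 \<Longrightarrow> good n (\<rho> n)" by metis
  define x where "x \<gamma> n = spec_score (M n) (dH n) (id_tensor (M n) (dK n) (dH n) (\<Lambda> n) (\<rho> n)) (exp (real n * \<gamma>))" for \<gamma> n
  have lim: "x \<gamma> \<longlonglongrightarrow> 1" if \<gamma>: "\<gamma> < R" for \<gamma>
  proof (rule tendsto_sandwich[OF _ _ _ tendsto_const])
    have x: "x \<gamma> n \<in> {1 - avg_error (\<Lambda> n) (M n) (\<rho>' n) (E n) - exp (real n * \<gamma>) / real (M n) .. 1}" if "n \<ge> 1" for n
      using good[OF that] by (simp add: good_def x_def)
    show "\<forall>\<^sub>F n in sequentially. x \<gamma> n \<le> 1"
      using x by (auto simp: eventually_sequentially intro!: exI[of _ 1])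
    show "\<forall>\<^sub>F n in sequentially. 1 - avg_error (\<Lambda> n) (M n) (\<rho>' n) (E n) - exp (- (R - \<gamma>)) ^ n \<le> x \<gamma> n"
      using rate eventually_ge_at_top[of 1]
    proof eventually_elim
      case (elim n)
      have "exp (real n * \<gamma>) / real (M n) \<le> exp (real n * \<gamma>) / exp (real n * R)"
        using elim(1) less_le_trans[OF exp_gt_zero elim(1)] by (intro divide_left_mono mult_pos_pos) auto
      also have "\<dots> = exp (- (R - \<gamma>)) ^ n"
        by (simp add: exp_diff[symmetric] exp_of_nat_mult[symmetric] algebra_simps)
      finally show ?case using x[OF elim(2)] by simp
    qed
    have "(\<lambda>n. exp (- (R - \<gamma>)) ^ n) \<longlonglongrightarrow> 0" using \<gamma> by (intro LIMSEQ_power_zero) simp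
    then have "(\<lambda>n. 1 - avg_error (\<Lambda> n) (M n) (\<rho>' n) (E n) - exp (- (R - \<gamma>)) ^ n) \<longlonglongrightarrow> 1 - 0 - 0"
      by (intro tendsto_diff tendsto_const err)
    then show "(\<lambda>n. 1 - avg_error (\<Lambda> n) (M n) (\<rho>' n) (E n) - exp (- (R - \<gamma>)) ^ n) \<longlonglongrightarrow> 1" by simp
  qed
  have "ereal R \<le> inf_spec_MI M dH (\<lambda>n. id_tensor (M n) (dK n) (dH n) (\<Lambda> n) (\<rho> n))"
  \<comment> \<open>The strict gap \<gamma> < R is needed for the geometric term to vanish, so
    \<open>R\<close> is approached from below.\<close>
  proof (rule dense_le)
    fix z assume "z < ereal R"
    then obtain \<gamma> where \<gamma>: "z < ereal \<gamma>" "\<gamma> < R" using ereal_dense2[of z "ereal R"] by auto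
    have "(\<lambda>n. ereal (x \<gamma> n)) \<longlonglongrightarrow> 1" using lim[OF \<gamma>(2)] by (simp add: one_ereal_def)
    then have "liminf (\<lambda>n. ereal (x \<gamma> n)) = 1" by (intro lim_imp_Liminf) auto
    then have "ereal \<gamma> \<le> inf_spec_MI M dH (\<lambda>n. id_tensor (M n) (dK n) (dH n) (\<Lambda> n) (\<rho> n))"
      unfolding inf_spec_MI_eq x_def by (intro Sup_upper) auto
    then show "z \<le> inf_spec_MI M dH (\<lambda>n. id_tensor (M n) (dK n) (dH n) (\<Lambda> n) (\<rho> n))"
      using \<gamma>(1) by simp
  qed
  moreover have "0 < M n \<and> density (M n * dK n) (\<rho> n) \<and> separable (M n) (dK n) (\<rho> n)" if "n \<ge> 1" for n
    using good[OF that] code[OF that] by (simp add: good_def is_code_def)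
  ultimately show ?thesis by (intro that)
qed

theorem theorem3:
  fixes dK dH :: "nat \<Rightarrow> nat" and \<Lambda> :: "nat \<Rightarrow> complex mat \<Rightarrow> complex mat"
  assumes "\<And>n. n \<ge> 1 \<Longrightarrow> 0 < dK n \<and> 0 < dH n"
    and "\<And>n. n \<ge> 1 \<Longrightarrow> cptp (dK n) (dH n) (\<Lambda> n)"
  shows "classical_capacity dK dH \<Lambda> =
    Sup {inf_spec_MI dA dH (\<lambda>n. id_tensor (dA n) (dK n) (dH n) (\<Lambda> n) (\<rho> n)) | dA \<rho>.
           \<forall>n\<ge>1. 0 < dA n \<and> density (dA n * dK n) (\<rho> n) \<and> separable (dA n) (dK n) (\<rho> n)}"
    (is "_ = Sup ?S")
proof (rule antisym)
  show "classical_capacity dK dH \<Lambda> \<le> Sup ?S"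
    unfolding classical_capacity_def
  proof (rule Sup_least)
    fix r assume "r \<in> ereal ` {R. achievable dK dH \<Lambda> R}"
    then obtain R where r: "r = ereal R" and R: "achievable dK dH \<Lambda> R" by auto
    obtain dA \<rho> where
      "\<And>n. n \<ge> 1 \<Longrightarrow> 0 < dA n \<and> density (dA n * dK n) (\<rho> n) \<and> separable (dA n) (dK n) (\<rho> n)"
      and le: "ereal R \<le> inf_spec_MI dA dH (\<lambda>n. id_tensor (dA n) (dK n) (dH n) (\<Lambda> n) (\<rho> n))"
      using achievable_le_inf_spec_MI[OF assms(2) R] by blast
    then have "inf_spec_MI dA dH (\<lambda>n. id_tensor (dA n) (dK n) (dH n) (\<Lambda> n) (\<rho> n)) \<in> ?S" by blast
    then show "r \<le> Sup ?S" unfolding r using le by (rule Sup_upper2)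
  qed
  show "Sup ?S \<le> classical_capacity dK dH \<Lambda>"
  proof (rule Sup_least)
    fix s assume "s \<in> ?S"
    then obtain dA \<rho> where s: "s = inf_spec_MI dA dH (\<lambda>n. id_tensor (dA n) (dK n) (dH n) (\<Lambda> n) (\<rho> n))"
      and \<rho>: "\<And>n. n \<ge> 1 \<Longrightarrow> density (dA n * dK n) (\<rho> n) \<and> separable (dA n) (dK n) (\<rho> n)"
      by blast
    show "s \<le> classical_capacity dK dH \<Lambda>"
      \<comment> \<open>Every \<gamma> in the set whose supremum defines the inf-spectral rate is
        itself achievable, so the two suprema are compared element by element.\<close>
      unfolding s inf_spec_MI_eq
    proof (rule Sup_least)
      fix g assume "g \<in> ereal ` {\<gamma>. liminf (\<lambda>n. ereal (spec_score (dA n) (dH n)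
         (id_tensor (dA n) (dK n) (dH n) (\<Lambda> n) (\<rho> n)) (exp (real n * \<gamma>)))) = 1}"
      then obtain \<gamma> where g: "g = ereal \<gamma>" and "liminf (\<lambda>n. ereal (spec_score (dA n) (dH n)
         (id_tensor (dA n) (dK n) (dH n) (\<Lambda> n) (\<rho> n)) (exp (real n * \<gamma>)))) = 1" by auto
      then have "achievable dK dH \<Lambda> \<gamma>"
        by (intro achievable_of_spec_score[OF assms(2) \<rho>]) auto
      then show "g \<le> classical_capacity dK dH \<Lambda>"
        unfolding classical_capacity_def g by (intro Sup_upper) auto
    qed
  qed
qed

end
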